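(* Let $d\geq 5$ and let $\mathcal{R}=\{A_0=I,A_1,\ldots,A_d\}$ be a symmetric $d$-class association scheme with minimal idempotents $E_0,E_1,\ldots,E_d$. If the fusing-idempotents $3$-hypergraph of $\mathcal{R}$ contains, as subhypergraphs, two different $3$-sunflowers on the vertex set $\{E_1,\ldots,E_d\}$, then $\mathcal{R}$ is amorphic.
   Context: Symmetric $d$-class association scheme: for a finite set $X$, a collection $\mathcal{R}=\{A_0,A_1,\ldots,A_d\}$ of nonzero $X\times X$ $\{0,1\}$-matrices such that $A_0=I$; $\sum_{i=0}^d A_i=J$ (all-one matrix); $A_i^\top=A_i$ for all $i$; and there are numbers $p_{ij}^h$ with $A_iA_j=\sum_{h=0}^d p_{ij}^hA_h$ for all $i,j$. The linear span of $A_0,\ldots,A_d$ (the Bose–Mesner algebra) has a unique basis of minimal (primitive) idempotents $E_0=\frac1{|X|}J,E_1,\ldots,E_d$, pairwise orthogonal with $\sum_j E_j=I$. Fusion: for a partition $\pi=\{\pi(0),\pi(1),\ldots,\pi(d')\}$ of $\{0,1,\ldots,d\}$ with $\pi(0)=\{0\}$, let $\mathcal{R}_\pi=\{\sum_{i\in\pi(s)}A_i : 0\le s\le d'\}$. If $\mathcal{R}_\pi$ is an association scheme it is called a fusion scheme of $\mathcal{R}$. $\mathcal{R}$ is amorphic if $\mathcal{R}_\pi$ is a fusion scheme for every such partition $\pi$. The minimal idempotents of a fusion scheme $\mathcal{R}_\pi$ are of the form $\sum_{j\in\rho(s)}E_j$, $0\le s\le d'$, for a unique partition $\rho=\{\rho(0),\ldots,\rho(d')\}$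 of $\{0,\ldots,d\}$ with $\rho(0)=\{0\}$. A set $\{E_j : j\in \mathcal{J}\}$ of idempotents ($\mathcal{J}\subseteq\{1,\ldots,d\}$) fuses if there is a fusion scheme $\mathcal{R}_\pi$ of $\mathcal{R}$ whose corresponding idempotent partition $\rho$ has as blocks $\mathcal{J}$ and the singletons $\{j\}$, $j\in\{0,\ldots,d\}\setminus\mathcal{J}$. The fusing-idempotents $3$-hypergraph of $\mathcal{R}$ is the $3$-uniform hypergraph on vertex set $\{E_1,\ldots,E_d\}$ in which three distinct vertices form an edge if and only if the set of these three idempotents fuses. A $3$-sunflower is a $3$-uniform hypergraph such that the intersection of all its edges is a set of size $2$ (its core) and the union of all its edges is its vertex set. Two $3$-sunflowers on a common vertex set are different if their cores are not the same. A hypergraph $\mathcal{H}_1$ is a subhypergraph of $\mathcal{H}_2$ if every edge of $\mathcal{H}_1$ is an edge of $\mathcal{H}_2$. *)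

theory Defs
  imports "HOL-Analysis.Analysis" "HOL-Library.Disjoint_Sets"
begin

definition all_ones :: "real ^ 'x ^ 'x" where
  "all_ones = (\<chi> x y. 1)"

(* The members of a scheme are indexed by an arbitrary finite set I, with e the index of the
   identity matrix, so that the same definition applies to a scheme A_0, ..., A_d (I = {0..d}, e = 0)
   and to its fusions, which are indexed by the blocks of a partition (e = {0}).
   Distinctness of the members follows from the conditions. *)
definition symmetric_association_scheme ::
    "'i set \<Rightarrow> 'i \<Rightarrow> ('i \<Rightarrow> real ^ 'x ^ 'x) \<Rightarrow> bool" where
  "symmetric_association_scheme I e A \<longleftrightarrow>
     finite I \<and> e \<in> I \<and>
     (\<forall>i\<in>I. A i \<noteq> 0 \<and> (\<forall>x y. A i $ x $ y \<in> {0, 1})) \<and>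
     A e = mat 1 \<and>
     (\<Sum>i\<in>I. A i) = all_ones \<and>
     (\<forall>i\<in>I. transpose (A i) = A i) \<and>
     (\<exists>p :: 'i \<Rightarrow> 'i \<Rightarrow> 'i \<Rightarrow> real.
        \<forall>i\<in>I. \<forall>j\<in>I. A i ** A j = (\<Sum>h\<in>I. p i j h *\<^sub>R A h))"

definition bose_mesner :: "'i set \<Rightarrow> ('i \<Rightarrow> real ^ 'x ^ 'x) \<Rightarrow> (real ^ 'x ^ 'x) set" where
  "bose_mesner I A = span (A ` I)"

(* Minimality refers to the usual order on idempotents: F below E iff E F = F E = F. *)
definition minimal_idempotents :: "(real ^ 'x ^ 'x) set \<Rightarrow> (real ^ 'x ^ 'x) set" where
  "minimal_idempotents B =
     {E \<in> B. E \<noteq> 0 \<and> E ** E = E \<and>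
        (\<forall>F\<in>B. F ** F = F \<and> E ** F = F \<and> F ** E = F \<longrightarrow> F = 0 \<or> F = E)}"

definition idempotent_labelling ::
    "nat \<Rightarrow> (nat \<Rightarrow> real ^ 'x ^ 'x) \<Rightarrow> (nat \<Rightarrow> real ^ 'x ^ 'x) \<Rightarrow> bool" where
  "idempotent_labelling d A E \<longleftrightarrow>
     bij_betw E {0..d} (minimal_idempotents (bose_mesner {0..d} A)) \<and>
     E 0 = (1 / real CARD('x)) *\<^sub>R all_ones"

definition pointed_partition :: "nat \<Rightarrow> nat set set \<Rightarrow> bool" where
  "pointed_partition d \<pi> \<longleftrightarrow> partition_on {0..d} \<pi> \<and> {0} \<in> \<pi>"

definition block_sum :: "(nat \<Rightarrow> real ^ 'x ^ 'x) \<Rightarrow> nat set \<Rightarrow> real ^ 'x ^ 'x" where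
  "block_sum A B = (\<Sum>i\<in>B. A i)"

definition is_fusion_scheme :: "nat \<Rightarrow> (nat \<Rightarrow> real ^ 'x ^ 'x) \<Rightarrow> nat set set \<Rightarrow> bool" where
  "is_fusion_scheme d A \<pi> \<longleftrightarrow>
     pointed_partition d \<pi> \<and> symmetric_association_scheme \<pi> {0} (block_sum A)"

definition amorphic :: "nat \<Rightarrow> (nat \<Rightarrow> real ^ 'x ^ 'x) \<Rightarrow> bool" where
  "amorphic d A \<longleftrightarrow> (\<forall>\<pi>. pointed_partition d \<pi> \<longrightarrow> is_fusion_scheme d A \<pi>)"

definition idempotent_partition ::
    "nat \<Rightarrow> (nat \<Rightarrow> real ^ 'x ^ 'x) \<Rightarrow> (nat \<Rightarrow> real ^ 'x ^ 'x) \<Rightarrow> nat set set \<Rightarrow> nat set set \<Rightarrow> bool" where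
  "idempotent_partition d A E \<pi> \<rho> \<longleftrightarrow>
     pointed_partition d \<rho> \<and>
     minimal_idempotents (bose_mesner \<pi> (block_sum A)) = block_sum E ` \<rho>"

(* The set of idempotents E_j, j in J, is represented by its index set J. *)
definition idempotents_fuse ::
    "nat \<Rightarrow> (nat \<Rightarrow> real ^ 'x ^ 'x) \<Rightarrow> (nat \<Rightarrow> real ^ 'x ^ 'x) \<Rightarrow> nat set \<Rightarrow> bool" where
  "idempotents_fuse d A E J \<longleftrightarrow>
     J \<subseteq> {1..d} \<and>
     (\<exists>\<pi>. is_fusion_scheme d A \<pi> \<and>
        idempotent_partition d A E \<pi> (insert J ((\<lambda>j. {j}) ` ({0..d} - J))))"

(* A hypergraph is a pair (vertex set, edge set). *)
type_synonym 'v hypergraph = "'v set \<times> 'v set set"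

definition uniform_hypergraph :: "nat \<Rightarrow> 'v hypergraph \<Rightarrow> bool" where
  "uniform_hypergraph k H \<longleftrightarrow> (\<forall>e\<in>snd H. e \<subseteq> fst H \<and> card e = k)"

definition subhypergraph :: "'v hypergraph \<Rightarrow> 'v hypergraph \<Rightarrow> bool" where
  "subhypergraph H1 H2 \<longleftrightarrow> snd H1 \<subseteq> snd H2"

definition core :: "'v hypergraph \<Rightarrow> 'v set" where
  "core H = \<Inter> (snd H)"

(* Nonemptiness of the edge set is explicit because the empty intersection is UNIV. *)
definition sunflower3 :: "'v hypergraph \<Rightarrow> bool" where
  "sunflower3 H \<longleftrightarrow>
     uniform_hypergraph 3 H \<and> snd H \<noteq> {} \<and> card (core H) = 2 \<and> \<Union> (snd H) = fst H"

definition fusing_idempotents_3_hypergraph ::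
    "nat \<Rightarrow> (nat \<Rightarrow> real ^ 'x ^ 'x) \<Rightarrow> (nat \<Rightarrow> real ^ 'x ^ 'x) \<Rightarrow> (real ^ 'x ^ 'x) hypergraph" where
  "fusing_idempotents_3_hypergraph d A E =
     (E ` {1..d}, {E ` J | J. J \<subseteq> {1..d} \<and> card J = 3 \<and> idempotents_fuse d A E J})"

end

theory Submission
  imports Defs
begin

text \<open>
  Let \<open>p r i\<close> be the eigenvalue of \<open>A i\<close> on the idempotent \<open>E r\<close>. For \<open>1 \<le> r, i \<le> d\<close>
  these numbers form \<open>d\<close> row vectors, and the orthogonality relations of the scheme say that for the
  form \<open>(x, y) = (\<Sum>i. x i * y i / k i)\<close>, with \<open>k i\<close> the valencies, two different rows have
  product \<open>- 1\<close> and a row has square \<open>\<mu> r - 1\<close> with \<open>\<mu> r > 0\<close>. So the rows are the vertices of a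
  simplex in which the edges at a vertex \<open>r\<close> have pairwise the same positive product \<open>\<mu> r\<close>, and
  opposite edges are orthogonal.

  If \<open>{E a, E b, E c}\<close> fuses, the fusion scheme merges the relations \<open>1, \<dots>, d\<close> into \<open>d - 2\<close> blocks, and rows
  \<open>a\<close>, \<open>b\<close>, \<open>c\<close> have the same sum over every block. The blocks other than singletons are one triple or
  two pairs, so these three rows differ in at most four columns.

  Let all \<open>{a, b, c}\<close> fuse for a fixed pair \<open>a\<close>, \<open>b\<close>, the core of a sunflower. Rows \<open>a\<close> and \<open>b\<close> then differ in two
  columns \<open>i\<close>, \<open>j\<close> only: otherwise every row would agree with row \<open>a\<close> in a column where \<open>a\<close> and \<open>b\<close> agree, and a
  constant column is impossible. Project the other rows along \<open>p a - p b\<close>, that is, subtract the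
  weighted mean of rows \<open>a\<close> and \<open>b\<close>, and merge columns \<open>i\<close> and \<open>j\<close>. Every remaining row
  becomes a multiple of a difference of two unit vectors, and any two of them have the same positive
  product. Such edges form a star with equal coefficients (\<open>equiangular_edges_form_star\<close>). The
  number of columns shows that the leaves of the star are all columns but its centre, so one sunflower
  determines the matrix up to the position of the centre and of rows \<open>a\<close>, \<open>b\<close>.

  A second sunflower with another core provides a fusing triple \<open>{s, c, c'}\<close> with \<open>s\<close> in \<open>{a, b}\<close> and
  \<open>c\<close>, \<open>c'\<close> outside. It forces the centre to be the merged column, and then forces rows \<open>a\<close> and \<open>b\<close>
  to have the same form as the others: \<open>p r i = \<alpha> i + x\<close> if \<open>i = \<sigma> r\<close> and \<open>p r i = \<alpha> i\<close> otherwise, for a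
  permutation \<open>\<sigma>\<close> (\<open>rows_of_two_sunflowers\<close>). With such eigenvalues, for every partition the span of
  the merged relations is also spanned by \<open>I\<close>, \<open>J\<close> and the idempotents obtained by merging the
  \<open>E r\<close> according to \<open>\<sigma>\<close>, so it is closed under multiplication (\<open>amorphic_if_single_shift\<close>).
\<close>

section \<open>Pairwise equiangular edges form a star\<close>

lemma weighted_inner_edge:
  fixes w y :: "'v \<Rightarrow> real"
  assumes "finite V" "h \<in> V" "t \<in> V" "h \<noteq> t"
    and "\<And>v. v \<in> V \<Longrightarrow> u v = (if v = h then x else if v = t then - x else 0)"
  shows "(\<Sum>v\<in>V. w v * u v * y v) = x * (w h * y h - w t * y t)"
proof -
  have "(\<Sum>v\<in>V. w v * u v * y v) = (\<Sum>v\<in>{h,t}. w v * u v * y v)"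
    using assms by (intro sum.mono_neutral_right) auto
  also have "\<dots> = x * (w h * y h - w t * y t)"
    using assms by (simp add: algebra_simps)
  finally show ?thesis .
qed

lemma third_element:
  assumes "3 \<le> card C"
  obtains c where "c \<in> C" "c \<noteq> a" "c \<noteq> b"
proof -
  have "\<not> C \<subseteq> {a, b}"
    using assms card_mono[of "{a, b}" C] card_insert_le_m1[of 2 "{b}" a] by auto
  then show ?thesis using that by blast
qed

text \<open>
  Two vectors with the same leaf would be proportional, and comparing their products with a
  third vector would make them equal, against the value of the squares. Hence for \<open>c \<noteq> c'\<close> only the
  centre contributes to the product, \<open>x c * x c' * w m = g\<close>, and three indices suffice to conclude
  that \<open>x\<close> is constant.
\<close>

lemma star_has_equal_coefficients:
  fixes z :: "'c \<Rightarrow> 'v \<Rightarrow> real"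
  assumes V: "finite V" "m \<in> V" and C: "3 \<le> card C"
    and k: "\<And>c. c \<in> C \<Longrightarrow> k c \<in> V \<and> k c \<noteq> m"
    and z: "\<And>c v. c \<in> C \<Longrightarrow> v \<in> V \<Longrightarrow> z c v = (if v = k c then x c else if v = m then - x c else 0)"
    and ip: "\<And>c c'. c \<in> C \<Longrightarrow> c' \<in> C \<Longrightarrow> c \<noteq> c' \<Longrightarrow> (\<Sum>v\<in>V. w v * z c v * z c' v) = g"
    and self: "\<And>c. c \<in> C \<Longrightarrow> (\<Sum>v\<in>V. w v * z c v * z c v) \<noteq> g"
    and g: "g \<noteq> 0"
  shows "inj_on k C" "\<exists>y. y \<noteq> 0 \<and> (\<forall>c\<in>C. x c = y)"
proof -
  have ip': "(\<Sum>v\<in>V. w v * z c v * u v) = x c * (w (k c) * u (k c) - w m * u m)"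
    if "c \<in> C" for c u
    using weighted_inner_edge[of V "k c" m "z c" "x c" w u] V k z that by auto
  show inj: "inj_on k C"
  proof (rule inj_onI, rule ccontr)
    fix c c' assume c: "c \<in> C" "c' \<in> C" "k c = k c'" "c \<noteq> c'"
    obtain e where e: "e \<in> C" "e \<noteq> c" "e \<noteq> c'" using third_element[OF C] by metis
    have "x c = x c'"
      using ip[of c e] ip[of c' e] c e g by (auto simp: ip')
    then have "(\<Sum>v\<in>V. w v * z c v * z c v) = (\<Sum>v\<in>V. w v * z c v * z c' v)"
      using c z by (intro sum.cong) auto
    then show False using ip[of c c'] self[of c] c by auto
  qed
  have prod: "x c * x c' * w m = g" if "c \<in> C" "c' \<in> C" "c \<noteq> c'" for c c'
  proof -
    have "k c \<noteq> k c'" using inj that by (auto dest: inj_onD)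
    then have "z c' (k c) = 0" "z c' m = - x c'" using z k that V by auto
    then show ?thesis using ip[OF that] ip'[of c "z c'"] that by (simp add: algebra_simps)
  qed
  obtain e where e: "e \<in> C" using third_element[OF C] by metis
  have "x c = x e" if c: "c \<in> C" for c
  proof -
    obtain f where f: "f \<in> C" "f \<noteq> c" "f \<noteq> e" using third_element[OF C] by metis
    then show ?thesis using prod[of c f] prod[of e f] c e g by auto
  qed
  moreover have "x e \<noteq> 0"
  proof -
    obtain f where "f \<in> C" "f \<noteq> e" using third_element[OF C] by metis
    then show ?thesis using prod[of e f] e g by auto
  qed
  ultimately show "\<exists>y. y \<noteq> 0 \<and> (\<forall>c\<in>C. x c = y)" by blast
qed

text \<open>
  If \<open>h c \<noteq> h c'\<close>, then \<open>t c = t c'\<close>, and any other index shares a head with at most one of \<open>c\<close>, \<open>c'\<close>,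
  so it shares this tail.
\<close>

lemma common_head_or_common_tail:
  assumes pair: "\<And>c c'. c \<in> C \<Longrightarrow> c' \<in> C \<Longrightarrow> h c = h c' \<or> t c = t c'"
  shows "(\<exists>m. \<forall>c\<in>C. h c = m) \<or> (\<exists>m. \<forall>c\<in>C. t c = m)"
  using assms by metis

text \<open>
  Orient every vector from its negative entry (tail) to its positive entry (head). A common head
  or a common tail contributes positively to the product of two vectors, a head that meets a tail
  negatively. As the products are positive, any two oriented edges share a head or a tail. This
  excludes triangles as well as disjoint edges.
\<close>

lemma equiangular_edges_form_star:
  fixes z :: "'c \<Rightarrow> 'v \<Rightarrow> real"
  assumes V: "finite V" and w: "\<And>v. v \<in> V \<Longrightarrow> 0 < w v" and C: "3 \<le> card C"
    and edge: "\<And>c. c \<in> C \<Longrightarrow>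
      \<exists>h\<in>V. \<exists>t\<in>V. h \<noteq> t \<and> z c h + z c t = 0 \<and> (\<forall>v\<in>V - {h, t}. z c v = 0)"
    and ip: "\<And>c c'. c \<in> C \<Longrightarrow> c' \<in> C \<Longrightarrow> c \<noteq> c' \<Longrightarrow> (\<Sum>v\<in>V. w v * z c v * z c' v) = g"
    and self: "\<And>c. c \<in> C \<Longrightarrow> (\<Sum>v\<in>V. w v * z c v * z c v) \<noteq> g"
    and g: "0 < g"
  obtains m x k where "m \<in> V" "x \<noteq> 0" "inj_on k C" "k ` C \<subseteq> V - {m}"
    "\<And>c v. c \<in> C \<Longrightarrow> v \<in> V \<Longrightarrow> z c v = (if v = k c then x else if v = m then - x else 0)"
proof -
  have "\<exists>h t y. h \<in> V \<and> t \<in> V \<and> h \<noteq> t \<and> y > 0 \<and>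
      (\<forall>v\<in>V. z c v = (if v = h then y else if v = t then - y else 0))" if c: "c \<in> C" for c
  proof -
    obtain h t where ht: "h \<in> V" "t \<in> V" "h \<noteq> t" "z c h + z c t = 0" "\<forall>v\<in>V - {h, t}. z c v = 0"
      using edge[OF c] by blast
    obtain e where e: "e \<in> C" "e \<noteq> c" using third_element[OF C] by metis
    have "z c h \<noteq> 0"
    proof
      assume "z c h = 0"
      then have "z c v = 0" if "v \<in> V" for v using ht that by force
      then have "(\<Sum>v\<in>V. w v * z c v * z e v) = 0" by (intro sum.neutral) auto
      then show False using ip[of c e] c e g by auto
    qed
    then consider "z c h > 0" | "z c t > 0" using ht(4) by linarith
    then show ?thesis
    proof cases
      case 1 with ht show ?thesis by (intro exI[of _ h] exI[of _ t] exI[of _ "z c h"]) auto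
    next
      case 2 with ht show ?thesis by (intro exI[of _ t] exI[of _ h] exI[of _ "z c t"]) auto
    qed
  qed
  then obtain h t y where hty: "\<And>c. c \<in> C \<Longrightarrow> h c \<in> V \<and> t c \<in> V \<and> h c \<noteq> t c \<and> y c > 0 \<and>
      (\<forall>v\<in>V. z c v = (if v = h c then y c else if v = t c then - y c else 0))"
    by metis
  have pair: "h c = h c' \<or> t c = t c'" if c: "c \<in> C" "c' \<in> C" for c c'
  proof (rule ccontr)
    assume n: "\<not> ?thesis"
    then have "c \<noteq> c'" by auto
    have "y c * (w (h c) * z c' (h c) - w (t c) * z c' (t c)) = g"
      using weighted_inner_edge[of V "h c" "t c" "z c" "y c" w "z c'"] hty[OF c(1)] V
        ip[OF c \<open>c \<noteq> c'\<close>] by auto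
    moreover have "w (h c) * z c' (h c) \<le> 0" "w (t c) * z c' (t c) \<ge> 0"
      using n hty[OF c(1)] hty[OF c(2)] w[of "h c"] w[of "t c"]
      by (auto simp: mult_nonneg_nonpos)
    ultimately show False
      using g hty[OF c(1)]
      by (smt (verit) mult_nonneg_nonpos)
  qed
  consider m where "\<forall>c\<in>C. h c = m" | m where "\<forall>c\<in>C. t c = m"
    using common_head_or_common_tail[of C h t] pair by blast
  then show ?thesis
  proof cases
    case 1
    have m: "m \<in> V" using 1 hty third_element[OF C] by metis
    note star = star_has_equal_coefficients[OF V m C, of t z "\<lambda>c. - y c" w g]
    have zt: "z c v = (if v = t c then - y c else if v = m then - (- y c) else 0)"
      if "c \<in> C" "v \<in> V" for c v
      using hty[OF that(1)] that 1 by auto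
    have kt: "t c \<in> V \<and> t c \<noteq> m" if "c \<in> C" for c using hty[OF that] that 1 by auto
    have inj: "inj_on t C" using star(1)[OF kt zt ip self] g by auto
    obtain x where "x \<noteq> 0" "\<forall>c\<in>C. - y c = x" using star(2)[OF kt zt ip self] g by auto
    then show ?thesis using that[of m x t] m inj kt zt by (auto simp: image_subset_iff)
  next
    case 2
    have m: "m \<in> V" using 2 hty third_element[OF C] by metis
    note star = star_has_equal_coefficients[OF V m C, of h z y w g]
    have zt: "z c v = (if v = h c then y c else if v = m then - y c else 0)"
      if "c \<in> C" "v \<in> V" for c v
      using hty[OF that(1)] that 2 by auto
    have kt: "h c \<in> V \<and> h c \<noteq> m" if "c \<in> C" for c using hty[OF that] that 2 by auto
    have inj: "inj_on h C" using star(1)[OF kt zt ip self] g by auto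
    obtain x where "x \<noteq> 0" "\<forall>c\<in>C. y c = x" using star(2)[OF kt zt ip self] g by auto
    then show ?thesis using that[of m x h] m inj kt zt by (auto simp: image_subset_iff)
  qed
qed

section \<open>Rows with equal sums over the blocks of a partition\<close>

text \<open>
  The surplus \<open>card B - 1\<close>, summed over the blocks \<open>B\<close>, is \<open>card I - card P = 2\<close>. So it is concentrated on
  one block of size three or on two blocks of size two.
\<close>

lemma partition_two_less:
  assumes P: "partition_on I P" and I: "finite I" and card: "card P + 2 = card I"
  shows "(\<exists>i j k. {i, j, k} \<subseteq> I \<and> distinct [i, j, k] \<and>
            (\<forall>l\<in>I - {i, j, k}. {l} \<in> P)) \<or>
         (\<exists>i j k l. {i, j, k, l} \<subseteq> I \<and> distinct [i, j, k, l] \<and> {i, j} \<in> P \<and> {k, l} \<in> P \<and>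
            (\<forall>m\<in>I - {i, j, k, l}. {m} \<in> P))"
proof -
  have fP: "finite P" using P I by (rule finite_elements[rotated])
  have fB: "finite B" "B \<noteq> {}" "B \<subseteq> I" if "B \<in> P" for B
    using P that I by (auto simp: partition_on_def intro: finite_subset)
  have c1: "card B \<ge> 1" if "B \<in> P" for B using fB[OF that] by (simp add: card_gt_0_iff Suc_le_eq)
  have sum: "(\<Sum>B\<in>P. card B - 1) = 2"
  proof -
    have "card I = (\<Sum>B\<in>P. card B)"
      using P fB by (metis card_Union_disjoint partition_onD1 partition_onD2 disjoint_def pairwise_def disjnt_def)
    also have "\<dots> = (\<Sum>B\<in>P. (card B - 1) + 1)"
      using le_add_diff_inverse2[OF c1] by (intro sum.cong) auto
    finally show ?thesis using card by (simp only: sum.distrib) simp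
  qed
  have single: "{l} \<in> P" if l: "l \<in> I" and "\<And>B. B \<in> P \<Longrightarrow> l \<in> B \<Longrightarrow> card B - 1 = 0" for l
  proof -
    obtain B where B: "B \<in> P" "l \<in> B" using P l by (auto simp: partition_on_def)
    then have "card B = 1" using that(2)[OF B] c1[OF B(1)] by simp
    then have "B = {l}" using B(2) by (metis card_1_singletonE singletonD)
    then show ?thesis using B by simp
  qed
  obtain B where B: "B \<in> P" "card B - 1 \<noteq> 0"
    using sum by (metis sum.neutral zero_neq_numeral)
  have sumB: "(card B - 1) + (\<Sum>B\<in>P - {B}. card B - 1) = 2"
    using sum B fP by (simp add: sum.remove)
  show ?thesis
  proof (cases "card B = 3")
    case True
    then obtain i j k where ijk: "B = {i, j, k}" "i \<noteq> j" "i \<noteq> k" "j \<noteq> k"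
      by (auto simp: card_3_iff)
    have "(\<Sum>B\<in>P - {B}. card B - 1) = 0" using sumB True by simp
    then have z: "card B' - 1 = 0" if "B' \<in> P" "B' \<noteq> B" for B'
      using that fP by (simp add: sum_eq_0_iff)
    have "{l} \<in> P" if "l \<in> I - {i, j, k}" for l
      using that z ijk by (intro single) auto
    moreover have "{i, j, k} \<subseteq> I" "distinct [i, j, k]" using ijk fB(3)[OF B(1)] by auto
    ultimately show ?thesis by blast
  next
    case False
    then have B2: "card B = 2" using B sumB by linarith
    then obtain i j where ij: "B = {i, j}" "i \<noteq> j" by (auto simp: card_2_iff)
    have s1: "(\<Sum>B\<in>P - {B}. card B - 1) = 1" using sumB B2 by simp
    then obtain B' where B': "B' \<in> P - {B}" "card B' - 1 \<noteq> 0"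
      by (metis sum.neutral zero_neq_one)
    have s2: "(card B' - 1) + (\<Sum>B\<in>P - {B} - {B'}. card B - 1) = 1"
      using s1 B' fP by (subst (asm) sum.remove[of _ B']) auto
    then have "card B' = 2" and s3: "(\<Sum>B\<in>P - {B} - {B'}. card B - 1) = 0" using B' by linarith+
    then obtain k l where kl: "B' = {k, l}" "k \<noteq> l" by (auto simp: card_2_iff)
    have disj: "B \<inter> B' = {}" using P B B' by (auto simp: partition_on_def disjoint_def)
    have z: "card C - 1 = 0" if "C \<in> P" "C \<noteq> B" "C \<noteq> B'" for C
      using that fP s3 by (simp add: sum_eq_0_iff)
    have "{m} \<in> P" if "m \<in> I - {i, j, k, l}" for m
      using that z ij kl by (intro single) auto
    moreover have "{i, j, k, l} \<subseteq> I" "distinct [i, j, k, l]"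
      using ij kl disj fB(3)[OF B(1)] fB(3)[of B'] B' by auto
    ultimately show ?thesis using ij kl B B' by (intro disjI2) blast
  qed
qed

text \<open>
  If a set \<open>R\<close> of three idempotents fuses, the corresponding partition of the relations other than the
  identity has two blocks fewer than there are relations; this is where the number two comes from.
\<close>

definition collapses :: "'i set \<Rightarrow> ('j \<Rightarrow> 'i \<Rightarrow> real) \<Rightarrow> 'j set \<Rightarrow> bool" where
  "collapses I p R \<longleftrightarrow> (\<exists>P. partition_on I P \<and> card P + 2 = card I \<and>
     (\<forall>B\<in>P. \<forall>r\<in>R. \<forall>s\<in>R. sum (p r) B = sum (p s) B))"

lemma collapses_cases:
  assumes "collapses I p R" and I: "finite I"
  obtains (triple) i j k where "{i, j, k} \<subseteq> I" "distinct [i, j, k]"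
      "\<And>l r s. l \<in> I - {i, j, k} \<Longrightarrow> r \<in> R \<Longrightarrow> s \<in> R \<Longrightarrow> p r l = p s l"
  | (pairs) i j k l where "{i, j, k, l} \<subseteq> I" "distinct [i, j, k, l]"
      "\<And>m r s. m \<in> I - {i, j, k, l} \<Longrightarrow> r \<in> R \<Longrightarrow> s \<in> R \<Longrightarrow> p r m = p s m"
      "\<And>r s. r \<in> R \<Longrightarrow> s \<in> R \<Longrightarrow> p r i + p r j = p s i + p s j"
      "\<And>r s. r \<in> R \<Longrightarrow> s \<in> R \<Longrightarrow> p r k + p r l = p s k + p s l"
proof -
  obtain P where P: "partition_on I P" "card P + 2 = card I"
    and eq: "\<And>B r s. B \<in> P \<Longrightarrow> r \<in> R \<Longrightarrow> s \<in> R \<Longrightarrow> sum (p r) B = sum (p s) B"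
    using assms(1) unfolding collapses_def by metis
  from partition_two_less[OF P(1) I P(2)] show ?thesis
  proof (elim disjE exE conjE)
    fix i j k assume "{i, j, k} \<subseteq> I" "distinct [i, j, k]" "\<forall>l\<in>I - {i, j, k}. {l} \<in> P"
    moreover have "p r l = p s l" if "{l} \<in> P" "r \<in> R" "s \<in> R" for l r s
      using eq[OF that] by simp
    ultimately show ?thesis using triple[of i j k] by blast
  next
    fix i j k l
    assume h: "{i, j, k, l} \<subseteq> I" "distinct [i, j, k, l]" "{i, j} \<in> P" "{k, l} \<in> P"
      "\<forall>m\<in>I - {i, j, k, l}. {m} \<in> P"
    show ?thesis
    proof (rule pairs[OF h(1,2)])
      show "p r m = p s m" if "m \<in> I - {i, j, k, l}" "r \<in> R" "s \<in> R" for m r s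
        using eq[of "{m}" r s] h(5) that by simp
      show "p r i + p r j = p s i + p s j" if "r \<in> R" "s \<in> R" for r s
        using eq[OF h(3) that] h(2) by simp
      show "p r k + p r l = p s k + p s l" if "r \<in> R" "s \<in> R" for r s
        using eq[OF h(4) that] h(2) by simp
    qed
  qed
qed

text \<open>
  If four columns are not constant on \<open>R\<close>, then these are the two pairs. Since pair sums agree, two rows
  that agree in one column also agree in its partner.
\<close>

lemma collapses_four_moved:
  assumes R: "collapses I p R" and I: "finite I"
    and four: "{i, j, u, v} \<subseteq> I" "distinct [i, j, u, v]"
    and moved: "\<And>l. l \<in> {i, j, u, v} \<Longrightarrow> \<exists>r\<in>R. \<exists>s\<in>R. p r l \<noteq> p s l"
    and rs: "r \<in> R" "s \<in> R"
  shows "l \<in> I - {i, j, u, v} \<Longrightarrow> p r l = p s l"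
    and "p r u = p s u \<Longrightarrow> p r i = p s i \<or> p r j = p s j \<or> p r v = p s v"
proof -
  have card4: "card {i, j, u, v} = 4" using four(2) by auto
  have "(l \<in> I - {i, j, u, v} \<longrightarrow> p r l = p s l) \<and>
    (p r u = p s u \<longrightarrow> p r i = p s i \<or> p r j = p s j \<or> p r v = p s v)"
    using R I
  proof (cases rule: collapses_cases)
    case (triple i' j' k')
    have "{i, j, u, v} \<subseteq> {i', j', k'}" using moved triple(3) four(1) by blast
    then have "card {i, j, u, v} \<le> card {i', j', k'}" by (intro card_mono) auto
    also have "\<dots> \<le> 3" using triple(2) by auto
    finally show ?thesis using card4 by simp
  next
    case (pairs i' j' k' l')
    have "{i, j, u, v} \<subseteq> {i', j', k', l'}" using moved pairs(3) four(1) by blast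
    moreover have "card {i', j', k', l'} = 4" using pairs(2) by auto
    ultimately have eq: "{i, j, u, v} = {i', j', k', l'}"
      using card4 by (intro card_subset_eq) auto
    have sums: "p r i' + p r j' = p s i' + p s j'" "p r k' + p r l' = p s k' + p s l'"
      using pairs(4,5) rs by blast+
    have "u \<in> {i', j', k', l'}" unfolding eq[symmetric] by simp
    then have "\<exists>u'. u' \<in> {i', j', k', l'} \<and> u' \<noteq> u \<and> (p r u = p s u \<longrightarrow> p r u' = p s u')"
    proof (elim insertE emptyE)
      assume "u = i'" then show ?thesis using sums pairs(2) by (intro exI[of _ j']) auto
    next
      assume "u = j'" then show ?thesis using sums pairs(2) by (intro exI[of _ i']) auto
    next
      assume "u = k'" then show ?thesis using sums pairs(2) by (intro exI[of _ l']) auto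
    next
      assume "u = l'" then show ?thesis using sums pairs(2) by (intro exI[of _ k']) auto
    qed
    then obtain u' where u': "u' \<in> {i', j', k', l'}" "u' \<noteq> u" "p r u = p s u \<longrightarrow> p r u' = p s u'"
      by blast
    have "u' \<in> {i, j, v}" using u'(1,2) unfolding eq[symmetric] by simp
    moreover have "l \<in> I - {i, j, u, v} \<longrightarrow> p r l = p s l"
      unfolding eq using pairs(3) rs by blast
    ultimately show ?thesis using u'(3) by auto
  qed
  then show "l \<in> I - {i, j, u, v} \<Longrightarrow> p r l = p s l"
    and "p r u = p s u \<Longrightarrow> p r i = p s i \<or> p r j = p s j \<or> p r v = p s v" by blast+
qed

text \<open>
  Rows \<open>a\<close> and \<open>b\<close> differ in both or in no column of a pair. If they differ in at least three columns,
  then they differ in all columns that the partition merges, and elsewhere row \<open>c\<close> agrees with both.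
\<close>

lemma collapses_three_moved:
  assumes R: "collapses I p {a, b, c}" and I: "finite I"
    and three: "3 \<le> card {l\<in>I. p a l \<noteq> p b l}" and l: "l \<in> I" "p a l = p b l"
  shows "p c l = p a l"
  using R I
proof (cases rule: collapses_cases)
  case (triple i j k)
  have "{l\<in>I. p a l \<noteq> p b l} \<subseteq> {i, j, k}" using triple(3) by blast
  then have "{l\<in>I. p a l \<noteq> p b l} = {i, j, k}"
    using three triple(2) by (intro card_seteq) auto
  then show ?thesis using triple(3)[of l c a] l by blast
next
  case (pairs i j k m)
  let ?D = "{l\<in>I. p a l \<noteq> p b l}"
  have D: "?D \<subseteq> {i, j, k, m}" using pairs(3) by blast
  have ij: "i \<in> ?D \<longleftrightarrow> j \<in> ?D" and km: "k \<in> ?D \<longleftrightarrow> m \<in> ?D"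
    using pairs(1) pairs(4,5)[of a b] by auto
  have "\<not> ?D \<subseteq> {k, m}" "\<not> ?D \<subseteq> {i, j}"
    using three card_mono[of "{k, m}" ?D] card_mono[of "{i, j}" ?D] pairs(2) by auto
  then have "{i, j, k, m} \<subseteq> ?D" using D ij km by auto
  then show ?thesis using pairs(3)[of l c a] l by blast
qed

lemma collapses_support:
  assumes "collapses I p R" and I: "finite I" and "r \<in> R" "s \<in> R"
  shows "card {l\<in>I. p r l \<noteq> p s l} \<le> 4"
  using assms(1,2)
proof (cases rule: collapses_cases)
  case (triple i j k)
  have "{l\<in>I. p r l \<noteq> p s l} \<subseteq> {i, j, k}" using triple(3) assms by blast
  then have "card {l\<in>I. p r l \<noteq> p s l} \<le> card {i, j, k}" by (intro card_mono) auto
  then show ?thesis using triple(2) by auto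
next
  case (pairs i j k m)
  have "{l\<in>I. p r l \<noteq> p s l} \<subseteq> {i, j, k, m}" using pairs(3) assms by blast
  then have "card {l\<in>I. p r l \<noteq> p s l} \<le> card {i, j, k, m}" by (intro card_mono) auto
  then show ?thesis using pairs(2) by auto
qed

text \<open>
  The first alternative comes from a triple \<open>{i, j, k}\<close>, the second from the pairs \<open>{i, j}\<close> and \<open>{k, l}\<close>;
  \<open>i\<close> and \<open>j\<close> must be paired because rows \<open>a\<close> and \<open>b\<close> differ in no other column.
\<close>

lemma collapses_around_moved_pair:
  assumes R: "collapses I p {a, b, c}" and I: "finite I"
    and ij: "i \<in> I" "j \<in> I" "i \<noteq> j" "p a i \<noteq> p b i" "p a j \<noteq> p b j"
    and off: "\<forall>l\<in>I - {i, j}. p a l = p b l"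
  shows "(\<exists>k\<in>I - {i, j}. \<forall>l\<in>I - {i, j, k}. p c l = p a l) \<or>
    (\<exists>k\<in>I - {i, j}. \<exists>l\<in>I - {i, j}. k \<noteq> l \<and> p c i + p c j = p a i + p a j \<and>
       p c k + p c l = p a k + p a l \<and> (\<forall>m\<in>I - {i, j, k, l}. p c m = p a m))"
  using R I
proof (cases rule: collapses_cases)
  case (triple i' j' k')
  have "i \<in> {i', j', k'}" "j \<in> {i', j', k'}"
    using triple(3)[of i a b] triple(3)[of j a b] ij by auto
  then have "card ({i', j', k'} - {i, j}) = 1"
    using triple(2) ij(3) by (subst card_Diff_subset) auto
  then obtain k where k: "{i', j', k'} - {i, j} = {k}" by (auto simp: card_1_singleton_iff)
  then have "k \<in> I - {i, j}" using triple(1) by blast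
  moreover have "p c l = p a l" if "l \<in> I - {i, j, k}" for l
    using that k triple(3)[of l c a] by blast
  ultimately show ?thesis by blast
next
  case (pairs i' j' k' l')
  have sums: "p a i' + p a j' = p b i' + p b j'" "p a k' + p a l' = p b k' + p b l'"
    using pairs(4,5)[of a b] by auto
  have moved: "l = i \<or> l = j" if "l \<in> I" "p a l \<noteq> p b l" for l using that off by blast
  have I': "i' \<in> I" "j' \<in> I" "k' \<in> I" "l' \<in> I" using pairs(1) by auto
  have "i \<in> {i', j', k', l'}" using pairs(3)[of i a b] ij by auto
  then have "{i', j'} = {i, j} \<or> {k', l'} = {i, j}"
  proof (elim insertE emptyE)
    assume "i = i'"
    then have "j' = j" using sums(1) ij(4) moved[OF I'(2)] pairs(2) by auto
    then show ?thesis using \<open>i = i'\<close> by simp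
  next
    assume "i = j'"
    then have "i' = j" using sums(1) ij(4) moved[OF I'(1)] pairs(2) by auto
    then show ?thesis using \<open>i = j'\<close> by auto
  next
    assume "i = k'"
    then have "l' = j" using sums(2) ij(4) moved[OF I'(4)] pairs(2) by auto
    then show ?thesis using \<open>i = k'\<close> by simp
  next
    assume "i = l'"
    then have "k' = j" using sums(2) ij(4) moved[OF I'(3)] pairs(2) by auto
    then show ?thesis using \<open>i = l'\<close> by auto
  qed
  then show ?thesis
  proof
    assume e: "{i', j'} = {i, j}"
    have "p c i + p c j = p a i + p a j"
      using e pairs(4)[of c a] by (auto simp: doubleton_eq_iff)
    moreover have "k' \<in> I - {i, j}" "l' \<in> I - {i, j}" "k' \<noteq> l'"
      unfolding e[symmetric] using pairs(1,2) by auto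
    moreover have "p c m = p a m" if "m \<in> I - {i, j, k', l'}" for m
    proof -
      have "m \<notin> {i', j'}" unfolding e using that by simp
      then show ?thesis using that pairs(3)[of m c a] by auto
    qed
    ultimately show ?thesis using pairs(5)[of c a] by blast
  next
    assume e: "{k', l'} = {i, j}"
    have "p c i + p c j = p a i + p a j"
      using e pairs(5)[of c a] by (auto simp: doubleton_eq_iff)
    moreover have "i' \<in> I - {i, j}" "j' \<in> I - {i, j}" "i' \<noteq> j'"
      unfolding e[symmetric] using pairs(1,2) by auto
    moreover have "p c m = p a m" if "m \<in> I - {i, j, i', j'}" for m
    proof -
      have "m \<notin> {k', l'}" unfolding e using that by simp
      then show ?thesis using that pairs(3)[of m c a] by auto
    qed
    ultimately show ?thesis using pairs(4)[of c a] by blast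
  qed
qed

section \<open>The row simplex of a scheme and its fusing triples\<close>

text \<open>
  The unit vector of column \<open>v\<close> after merging columns \<open>i\<close> and \<open>j\<close>, spread back to the original columns: the
  merged column is named \<open>i\<close>, and its weight is distributed over \<open>i\<close> and \<open>j\<close> in the ratio
  \<open>\<kappa> : 1 - \<kappa>\<close>.
\<close>

definition merged_unit :: "'i \<Rightarrow> 'i \<Rightarrow> real \<Rightarrow> 'i \<Rightarrow> 'i \<Rightarrow> real" where
  "merged_unit i j \<kappa> v l =
     (if v = i then if l = i then \<kappa> else if l = j then 1 - \<kappa> else 0
      else if l = v then 1 else 0)"

text \<open>
  The part of a scheme that the argument needs. \<open>p r i\<close> is the eigenvalue of relation \<open>i\<close> on idempotent \<open>r\<close>,
  \<open>k\<close> the valencies and \<open>\<mu>\<close> the number of points divided by the multiplicities. The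
  identity relation and the trivial idempotent are left out; they account for the \<open>- 1\<close> in the Gram
  matrix and in the row sums.
\<close>

locale eigenvalue_rows =
  fixes I :: "'i set" and J :: "'j set" and p :: "'j \<Rightarrow> 'i \<Rightarrow> real"
    and k :: "'i \<Rightarrow> real" and \<mu> :: "'j \<Rightarrow> real"
  assumes finite_I: "finite I" and card_J: "card J = card I" and card_I: "5 \<le> card I"
    and k_pos: "i \<in> I \<Longrightarrow> 0 < k i" and \<mu>_pos: "r \<in> J \<Longrightarrow> 0 < \<mu> r"
    and gram: "r \<in> J \<Longrightarrow> s \<in> J \<Longrightarrow>
      (\<Sum>i\<in>I. 1 / k i * p r i * p s i) = (if r = s then \<mu> r else 0) - 1"
    and row_sum: "r \<in> J \<Longrightarrow> sum (p r) I = - 1"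
    and column_moved: "i \<in> I \<Longrightarrow> \<exists>r\<in>J. \<exists>s\<in>J. p r i \<noteq> p s i"
begin

definition ip :: "('i \<Rightarrow> real) \<Rightarrow> ('i \<Rightarrow> real) \<Rightarrow> real" where
  "ip x y = (\<Sum>i\<in>I. 1 / k i * x i * y i)"

lemma ip_linear:
  "ip (\<lambda>i. x i - y i) u = ip x u - ip y u" "ip u (\<lambda>i. x i - y i) = ip u x - ip u y"
  "ip (\<lambda>i. x i + y i) u = ip x u + ip y u" "ip u (\<lambda>i. x i + y i) = ip u x + ip u y"
  "ip (\<lambda>i. c * x i) u = c * ip x u" "ip u (\<lambda>i. c * x i) = c * ip u x"
  unfolding ip_def
  by (simp_all add: algebra_simps diff_divide_distrib add_divide_distrib
      sum.distrib sum_subtractf sum_distrib_left)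

lemma ip_rows: "r \<in> J \<Longrightarrow> s \<in> J \<Longrightarrow> ip (p r) (p s) = (if r = s then \<mu> r else 0) - 1"
  using gram by (simp add: ip_def)

lemma row_sums_agree_off:
  assumes "r \<in> J" "s \<in> J" "i \<in> I" "j \<in> I" "i \<noteq> j" "\<And>l. l \<in> I - {i, j} \<Longrightarrow> p r l = p s l"
  shows "p r i + p r j = p s i + p s j"
proof -
  have "0 = (\<Sum>l\<in>I. p r l - p s l)" using row_sum assms by (simp add: sum_subtractf)
  also have "\<dots> = (\<Sum>l\<in>{i, j}. p r l - p s l)"
    using assms finite_I by (intro sum.mono_neutral_right) auto
  finally show ?thesis using assms by simp
qed

text \<open>
  If rows \<open>a\<close> and \<open>b\<close> differed in three or more columns, then in a column where they agree, which exists
  because they differ in at most four, all rows would agree, and this column would be constant. They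
  cannot differ in just one column because the row sums are equal.
\<close>

lemma core_rows_differ_in_two_columns:
  assumes ab: "a \<in> J" "b \<in> J" "a \<noteq> b" and c: "\<And>c. c \<in> J - {a, b} \<Longrightarrow> collapses I p {a, b, c}"
  obtains i j where "i \<in> I" "j \<in> I" "i \<noteq> j" "p a i \<noteq> p b i"
    "p a i + p a j = p b i + p b j" "\<And>l. l \<in> I - {i, j} \<Longrightarrow> p a l = p b l"
proof -
  define D where "D = {l\<in>I. p a l \<noteq> p b l}"
  have fD: "finite D" using finite_I by (simp add: D_def)
  obtain e where e: "e \<in> J" "e \<noteq> a" "e \<noteq> b"
    using third_element[of J a b] card_J card_I by auto
  have "card D \<le> 4" unfolding D_def using collapses_support[OF c[of e] finite_I, of a b] e by auto
  have "card D < 3"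
  proof (rule ccontr)
    assume "\<not> card D < 3"
    have "\<not> I \<subseteq> D" using \<open>card D \<le> 4\<close> card_I card_mono[OF fD, of I] by auto
    then obtain l where l: "l \<in> I" "p a l = p b l" by (auto simp: D_def)
    have "p r l = p a l" if "r \<in> J" for r
      using that l collapses_three_moved[OF c[of r] finite_I _ l] \<open>\<not> card D < 3\<close>
      by (cases "r = a \<or> r = b") (auto simp: D_def)
    then show False using column_moved[OF l(1)] by metis
  qed
  moreover have "card D \<noteq> 0"
  proof
    assume "card D = 0"
    then have "\<And>l. l \<in> I \<Longrightarrow> p a l = p b l" using fD by (auto simp: D_def)
    then have "ip (p a) (p a) = ip (p a) (p b)" unfolding ip_def by (intro sum.cong) auto
    then show False using ip_rows[of a a] ip_rows[of a b] ab \<mu>_pos[of a] by simp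
  qed
  moreover have "card D \<noteq> 1"
  proof
    assume "card D = 1"
    then obtain i where D: "D = {i}" by (auto simp: card_1_singleton_iff)
    have "0 = (\<Sum>l\<in>I. p a l - p b l)" using row_sum ab by (simp add: sum_subtractf)
    also have "\<dots> = (\<Sum>l\<in>D. p a l - p b l)"
      unfolding D_def using finite_I by (intro sum.mono_neutral_right) auto
    finally show False using D by (auto simp: D_def)
  qed
  ultimately have "card D = 2" by linarith
  then obtain i j where D: "D = {i, j}" "i \<noteq> j" by (auto simp: card_2_iff)
  then have "i \<in> I" "j \<in> I" "p a i \<noteq> p b i" and off: "\<And>l. l \<in> I - {i, j} \<Longrightarrow> p a l = p b l"
    by (auto simp: D_def)
  with row_sums_agree_off[OF ab(1,2) _ _ D(2)] show ?thesis using that[of i j] D(2) by auto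
qed

text \<open>
  The structure that one sunflower with core \<open>{a, b}\<close> imposes. With \<open>\<beta>\<close> the mean of rows \<open>a\<close> and \<open>b\<close> in which
  row \<open>a\<close> has weight proportional to \<open>\<mu> b\<close> and conversely, every \<open>p c - \<beta>\<close> is orthogonal to \<open>p a - p b\<close>, a multiple of
  \<open>e i - e j\<close>. So its entries in columns \<open>i\<close> and \<open>j\<close> are proportional to \<open>k i\<close> and \<open>k j\<close>, and
  merging these columns loses no information. The merged vectors are edges with constant
  positive products, hence a star with some centre \<open>m\<close>, which may be the merged column.
\<close>

lemma rows_around_core:
  assumes ab: "a \<in> J" "b \<in> J" "a \<noteq> b" and core: "\<And>c. c \<in> J - {a, b} \<Longrightarrow> collapses I p {a, b, c}"
  obtains i j \<beta> y \<kappa> m x q where "i \<in> I" "j \<in> I" "i \<noteq> j" "0 < \<kappa>" "\<kappa> < 1"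
    "\<And>s. s \<in> {a, b} \<Longrightarrow> y s \<noteq> 0"
    "\<And>s l. s \<in> {a, b} \<Longrightarrow> l \<in> I \<Longrightarrow>
       p s l = \<beta> l + (if l = i then y s else if l = j then - y s else 0)"
    "m \<in> I - {j}" "x \<noteq> 0" "bij_betw q (J - {a, b}) (I - {j, m})"
    "\<And>c l. c \<in> J - {a, b} \<Longrightarrow> l \<in> I \<Longrightarrow>
       p c l = \<beta> l + x * (merged_unit i j \<kappa> (q c) l - merged_unit i j \<kappa> m l)"
proof -
  obtain i j where ij: "i \<in> I" "j \<in> I" "i \<noteq> j" "p a i \<noteq> p b i"
    and ij_sum: "p a i + p a j = p b i + p b j" and off: "\<And>l. l \<in> I - {i, j} \<Longrightarrow> p a l = p b l"
    using core_rows_differ_in_two_columns[OF ab core] by metis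
  define t where "t = p a i - p b i"
  have t: "t \<noteq> 0" using ij(4) by (simp add: t_def)
  have finJ: "finite J" using card_J card_I by (intro card_ge_0_finite) auto
  define s\<^sub>a s\<^sub>b where "s\<^sub>a = \<mu> b / (\<mu> a + \<mu> b)" and "s\<^sub>b = \<mu> a / (\<mu> a + \<mu> b)"
  have \<mu>: "\<mu> a > 0" "\<mu> b > 0" using \<mu>_pos ab by auto
  have s: "s\<^sub>a > 0" "s\<^sub>b > 0" "s\<^sub>a + s\<^sub>b = 1" "s\<^sub>a * \<mu> a = s\<^sub>b * \<mu> b"
    using \<mu> unfolding s\<^sub>a_def s\<^sub>b_def by (simp_all add: add_divide_distrib[symmetric])
  \<comment> \<open>These weights make \<open>p c - \<beta>\<close> orthogonal to \<open>p a - p b\<close>.\<close>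
  define \<beta> where "\<beta> l = s\<^sub>a * p a l + s\<^sub>b * p b l" for l
  define z where "z c l = p c l - \<beta> l" for c l
  have \<beta>_alt: "\<beta> l = p a l - s\<^sub>b * (p a l - p b l)" "\<beta> l = p b l + s\<^sub>a * (p a l - p b l)" for l
  proof -
    have sb: "s\<^sub>b = 1 - s\<^sub>a" using s(3) by simp
    show "\<beta> l = p a l - s\<^sub>b * (p a l - p b l)" "\<beta> l = p b l + s\<^sub>a * (p a l - p b l)"
      unfolding \<beta>_def sb by (simp_all add: algebra_simps)
  qed
  have \<beta>_off: "\<beta> l = p a l" if "l \<in> I - {i, j}" for l using \<beta>_alt(1)[of l] off[OF that] by simp
  have tj: "p a j - p b j = - t" using ij_sum by (simp add: t_def)
  have \<beta>_sum: "\<beta> i + \<beta> j = p a i + p a j"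
    using tj by (simp add: \<beta>_alt(1) t_def[symmetric])
  define g where "g = s\<^sub>a * s\<^sub>a * \<mu> a + s\<^sub>b * s\<^sub>b * \<mu> b"
  have g: "g > 0" using s \<mu> unfolding g_def by (simp add: add_pos_pos)
  have zz: "ip (z c) (z c') = g + (if c = c' then \<mu> c else 0)"
    if "c \<in> J - {a, b}" "c' \<in> J - {a, b}" for c c'
  proof -
    have sb: "s\<^sub>b = 1 - s\<^sub>a" using s(3) by simp
    show ?thesis
      using that ab unfolding z_def \<beta>_def g_def
      by (auto simp: ip_linear ip_rows sb algebra_simps)
  qed
  have zw: "z c i / k i = z c j / k j" if "c \<in> J - {a, b}" for c
  proof -
    have "ip (\<lambda>l. p a l - p b l) (z c) = 0"
      using that ab s unfolding z_def \<beta>_def by (auto simp: ip_linear ip_rows algebra_simps)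
    moreover have "ip (\<lambda>l. p a l - p b l) (z c) = t * (1 / k i * z c i - 1 / k j * z c j)"
      unfolding ip_def using finite_I ij off tj
      by (intro weighted_inner_edge) (auto simp: t_def)
    ultimately show ?thesis using t by simp
  qed
  define \<kappa> where "\<kappa> = k i / (k i + k j)"
  have k: "k i > 0" "k j > 0" using k_pos ij by auto
  have \<kappa>: "0 < \<kappa>" "\<kappa> < 1" using k by (simp_all add: \<kappa>_def)
  define V where "V = I - {j}"
  define z' where "z' c l = (if l = i then z c i + z c j else z c l)" for c l
  have z'_i: "z c i = \<kappa> * z' c i" "z c j = (1 - \<kappa>) * z' c i" if "c \<in> J - {a, b}" for c
    using zw[OF that] k unfolding z'_def \<kappa>_def by (simp_all add: field_simps)
  \<comment> \<open>With this weight of the merged column, merging preserves products of vectors whose entries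
    in columns \<open>i\<close> and \<open>j\<close> are in the ratio \<open>\<kappa> : 1 - \<kappa>\<close>.\<close>
  define w where "w l = (if l = i then 1 / (k i + k j) else 1 / k l)" for l
  have V: "finite V" "i \<in> V" using finite_I ij by (auto simp: V_def)
  have w: "w l > 0" if "l \<in> V" for l
    using that k k_pos unfolding w_def V_def by auto
  have ip': "(\<Sum>l\<in>V. w l * z' c l * z' c' l) = ip (z c) (z c')"
    if c: "c \<in> J - {a, b}" "c' \<in> J - {a, b}" for c c'
  proof -
    have 1: "(\<Sum>l\<in>V - {i}. w l * z' c l * z' c' l) = (\<Sum>l\<in>V - {i}. 1 / k l * z c l * z c' l)"
      by (intro sum.cong) (auto simp: w_def z'_def)
    have kk: "k i + k j \<noteq> 0" using k by simp
    have "1 / k i * (\<kappa> * A) * (\<kappa> * B) + 1 / k j * (\<kappa>' * A) * (\<kappa>' * B) =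
        A * B * (\<kappa> * \<kappa> / k i + \<kappa>' * \<kappa>' / k j)" for A B \<kappa>'
      by (simp add: algebra_simps)
    moreover have "\<kappa> * \<kappa> / k i + (1 - \<kappa>) * (1 - \<kappa>) / k j = 1 / (k i + k j)"
    proof -
      have "1 - \<kappa> = k j / (k i + k j)" unfolding \<kappa>_def using kk by (simp add: field_simps)
      then have "\<kappa> * \<kappa> / k i + (1 - \<kappa>) * (1 - \<kappa>) / k j = (k i + k j) / ((k i + k j) * (k i + k j))"
        unfolding \<kappa>_def using k by (simp add: add_divide_distrib)
      then show ?thesis using kk by simp
    qed
    ultimately have 2: "w i * z' c i * z' c' i = 1 / k i * z c i * z c' i + 1 / k j * z c j * z c' j"
      using z'_i[OF c(1)] z'_i[OF c(2)] by (simp add: w_def)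
    have "ip (z c) (z c') = 1 / k j * z c j * z c' j +
        (1 / k i * z c i * z c' i + (\<Sum>l\<in>V - {i}. 1 / k l * z c l * z c' l))"
      unfolding ip_def sum.remove[OF finite_I ij(2)] V_def[symmetric] sum.remove[OF V] by simp
    then show ?thesis using 1 2 V by (simp add: sum.remove[of V i])
  qed
  define C where "C = J - {a, b}"
  have card_C: "card C = card I - 2" using ab card_J finJ by (simp add: C_def card_Diff_subset)
  have edge: "\<exists>h\<in>V. \<exists>u\<in>V. h \<noteq> u \<and> z' c h + z' c u = 0 \<and> (\<forall>v\<in>V - {h, u}. z' c v = 0)"
    if c: "c \<in> C" for c
  proof -
    have cJ: "c \<in> J" using c by (simp add: C_def)
    have z_off: "z c l = p c l - p a l" if "l \<in> I - {i, j}" for l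
      using \<beta>_off[OF that] by (simp add: z_def)
    have z'_v: "z' c i = p c i + p c j - (p a i + p a j)" using \<beta>_sum by (simp add: z'_def z_def)
    have "p a j \<noteq> p b j" "\<forall>l\<in>I - {i, j}. p a l = p b l" using tj t off by auto
    from collapses_around_moved_pair[OF core[OF c[unfolded C_def]] finite_I ij this]
    consider (T) h where "h \<in> I - {i, j}" "\<forall>l\<in>I - {i, j, h}. p c l = p a l"
      | (M) h u where "h \<in> I - {i, j}" "u \<in> I - {i, j}" "h \<noteq> u" "p c i + p c j = p a i + p a j"
        "p c h + p c u = p a h + p a u" "\<forall>l\<in>I - {i, j, h, u}. p c l = p a l"
      by (elim disjE bexE conjE)
    then show ?thesis
    proof cases
      case T
      have "0 = (\<Sum>l\<in>I. p c l - p a l)" using row_sum cJ ab by (simp add: sum_subtractf)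
      also have "\<dots> = (\<Sum>l\<in>{i, j, h}. p c l - p a l)"
        using T ij finite_I by (intro sum.mono_neutral_right) auto
      also have "\<dots> = p c i + p c j - (p a i + p a j) + (p c h - p a h)" using T ij by auto
      finally have "z' c i + z' c h = 0" using z'_v z_off[OF T(1)] T(1) by (simp add: z'_def)
      moreover have "z' c v = 0" if "v \<in> V - {i, h}" for v
        using that T z_off[of v] by (simp add: z'_def V_def)
      ultimately show ?thesis using V T(1) by (intro bexI[of _ i] bexI[of _ h]) (auto simp: V_def)
    next
      case M
      have "z' c h + z' c u = 0" using M(1-3,5) z_off[of h] z_off[of u] by (simp add: z'_def)
      moreover have "z' c v = 0" if "v \<in> V - {h, u}" for v
        using that M z_off[of v] z'_v by (cases "v = i") (simp_all add: V_def z'_def)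
      ultimately show ?thesis using M(1-3) by (intro bexI[of _ h] bexI[of _ u]) (auto simp: V_def)
    qed
  qed
  obtain m x q where star: "m \<in> V" "x \<noteq> 0" "inj_on q C" "q ` C \<subseteq> V - {m}"
    and z'_eq: "\<And>c v. c \<in> C \<Longrightarrow> v \<in> V \<Longrightarrow> z' c v = (if v = q c then x else if v = m then - x else 0)"
  proof (rule equiangular_edges_form_star[of V w C z' g, OF V(1) w _ edge])
    show "3 \<le> card C" using card_C card_I by simp
    show "(\<Sum>v\<in>V. w v * z' c v * z' c' v) = g" if "c \<in> C" "c' \<in> C" "c \<noteq> c'" for c c'
      using that ip'[of c c'] zz[of c c'] by (simp add: C_def)
    show "(\<Sum>v\<in>V. w v * z' c v * z' c v) \<noteq> g" if "c \<in> C" for c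
      using that ip'[of c c] zz[of c c] \<mu>_pos[of c] by (simp add: C_def)
  qed (use g in auto)
  \<comment> \<open>There are exactly as many edges as columns other than the centre, so every column is a leaf.\<close>
  have "card (V - {m}) = card C" using star(1) V ij card_C finite_I by (simp add: V_def)
  then have "q ` C = V - {m}"
    using star V by (intro card_subset_eq) (auto simp: card_image)
  moreover have "V - {m} = I - {j, m}" by (auto simp: V_def)
  ultimately have bij: "bij_betw q C (I - {j, m})" using star(3) by (simp add: bij_betw_def)
  have rows: "p c l = \<beta> l + x * (merged_unit i j \<kappa> (q c) l - merged_unit i j \<kappa> m l)"
    if c: "c \<in> C" and l: "l \<in> I" for c l
  proof -
    have qc: "q c \<in> V" "q c \<noteq> m" "q c \<noteq> j" "m \<noteq> j" using star(1,4) c by (auto simp: V_def)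
    have zi: "z' c i = x * (of_bool (q c = i) - of_bool (m = i))"
      using z'_eq[OF c V(2)] qc by auto
    have "z c l = x * (merged_unit i j \<kappa> (q c) l - merged_unit i j \<kappa> m l)"
    proof (cases "l = i \<or> l = j")
      case True
      then show ?thesis using z'_i[of c] c zi ij(3) qc by (auto simp: merged_unit_def C_def)
    next
      case False
      then have "z c l = z' c l" "l \<in> V" using l by (auto simp: z'_def V_def)
      then show ?thesis using False z'_eq[OF c, of l] qc by (auto simp: merged_unit_def)
    qed
    then show ?thesis by (simp add: z_def)
  qed
  define y where "y r = (if r = a then s\<^sub>b * t else - s\<^sub>a * t)" for r
  show ?thesis
  proof (rule that[of i j \<kappa> y \<beta> m x q])
    show "y r \<noteq> 0" if "r \<in> {a, b}" for r using that s t by (auto simp: y_def)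
    show "p r l = \<beta> l + (if l = i then y r else if l = j then - y r else 0)"
      if "r \<in> {a, b}" "l \<in> I" for r l
    proof -
      have d: "p a l - p b l = (if l = i then t else if l = j then - t else 0)"
        using that(2) tj off[of l] by (auto simp: t_def)
      consider "r = a" | "r = b" "a \<noteq> b" using \<open>r \<in> {a, b}\<close> ab(3) by blast
      then show ?thesis
        by cases (use \<beta>_alt[of l] in \<open>auto simp: d y_def split: if_splits\<close>)
    qed
  qed (use ij \<kappa> star bij rows in \<open>auto simp: V_def C_def\<close>)
qed

text \<open>
  Suppose that the centre \<open>m\<close> is another column and, by symmetry, that \<open>c\<close> is not attached to the
  merged column. Then rows \<open>s\<close> and \<open>c\<close> differ in the four columns \<open>i\<close>, \<open>j\<close>, \<open>m\<close>, \<open>q c\<close>, so these are the two pairs of the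
  partition. If \<open>c'\<close> is attached to a further column \<open>q c'\<close>, this is a fifth column where rows differ. If \<open>c'\<close>
  is attached to the merged column, then rows \<open>c\<close> and \<open>c'\<close> agree in column \<open>m\<close> alone of the four, against
  the pairing.
\<close>

lemma star_centre_is_merged_column:
  assumes ij: "i \<in> I" "j \<in> I" "i \<noteq> j" and \<kappa>: "0 < \<kappa>" "\<kappa> < 1"
    and y: "\<And>s. s \<in> {a, b} \<Longrightarrow> y s \<noteq> 0"
    and core_rows: "\<And>s l. s \<in> {a, b} \<Longrightarrow> l \<in> I \<Longrightarrow>
       p s l = \<beta> l + (if l = i then y s else if l = j then - y s else 0)"
    and m: "m \<in> I - {j}" and x: "x \<noteq> 0" and q: "bij_betw q (J - {a, b}) (I - {j, m})"
    and rows: "\<And>c l. c \<in> J - {a, b} \<Longrightarrow> l \<in> I \<Longrightarrow>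
       p c l = \<beta> l + x * (merged_unit i j \<kappa> (q c) l - merged_unit i j \<kappa> m l)"
    and s: "s \<in> {a, b}" and c: "c \<in> J - {a, b}" and c': "c' \<in> J - {a, b}" and cc': "c \<noteq> c'"
    and fuse: "collapses I p {s, c, c'}"
  shows "m = i"
proof -
  have contra: False
    if mi: "m \<noteq> i" and c: "c \<in> J - {a, b}" and c': "c' \<in> J - {a, b}" and cc': "c \<noteq> c'"
      and qi: "q c \<noteq> i" and fuse: "collapses I p {s, c, c'}" for c c'
  proof -
    have qc: "q c \<in> I - {j, m}" "q c' \<in> I - {j, m}" "q c \<noteq> q c'"
      using bij_betw_apply[OF q c] bij_betw_apply[OF q c'] inj_on_eq_iff[OF bij_betw_imp_inj_on[OF q] c c'] cc' by auto
    have mI: "m \<in> I" "m \<noteq> j" using m by auto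
    have d: "distinct [i, j, m, q c]" using ij mi mI qi qc by auto
    have sc: "p s l \<noteq> p c l" if "l \<in> {i, j, m, q c}" for l
      using that core_rows[OF s, of l] rows[OF c, of l] d mI ij qc y[OF s] x
      by (auto simp: merged_unit_def)
    have four: "{i, j, m, q c} \<subseteq> I" using ij mI qc by auto
    have moved: "\<exists>r\<in>{s, c, c'}. \<exists>r'\<in>{s, c, c'}. p r l \<noteq> p r' l" if "l \<in> {i, j, m, q c}" for l
      using sc[OF that] by blast
    note fm = collapses_four_moved[OF fuse finite_I four d moved]
    show False
    proof (cases "q c' = i")
      case False
      have "p s (q c') = p c' (q c')"
        using fm(1)[of s c' "q c'"] False qc by auto
      then show False using core_rows[OF s, of "q c'"] rows[OF c', of "q c'"] False qc x mi
        by (auto simp: merged_unit_def)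
    next
      case True
      have "p c m = p c' m" "p c i \<noteq> p c' i" "p c j \<noteq> p c' j" "p c (q c) \<noteq> p c' (q c)"
        using rows[OF c] rows[OF c'] ij mI True qc d x \<kappa> by (auto simp: merged_unit_def)
      then show False using fm(2)[of c c'] by auto
    qed
  qed
  have fuse': "collapses I p {s, c', c}" using fuse by (simp add: insert_commute)
  have "q c \<noteq> i \<or> q c' \<noteq> i" using inj_on_eq_iff[OF bij_betw_imp_inj_on[OF q] c c'] cc' by auto
  then show ?thesis using contra[OF _ c c' cc' _ fuse] contra[OF _ c' c cc'[symmetric] _ fuse'] by auto
qed

text \<open>
  Once the centre is the merged column, rows outside the core have the required form with base
  \<open>\<alpha>\<close>, and a core row differs from \<open>\<alpha>\<close> only in columns \<open>i\<close> and \<open>j\<close>, by amounts with sum \<open>x\<close>. If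
  both amounts were nonzero for \<open>s\<close>, rows \<open>s\<close> and \<open>c\<close> would differ in three columns of the two
  pairs \<open>{i, j, q c, q c'}\<close> and agree in the fourth. So row \<open>s\<close> has the required form. For the other core row \<open>s'\<close>, this
  follows from the orthogonality of \<open>p s - p c\<close> and \<open>p s' - p c'\<close>.
\<close>

lemma rows_of_two_sunflowers:
  assumes ab: "a \<in> J" "b \<in> J" "a \<noteq> b" and core: "\<And>c. c \<in> J - {a, b} \<Longrightarrow> collapses I p {a, b, c}"
    and s: "s \<in> {a, b}" and c: "c \<in> J - {a, b}" and c': "c' \<in> J - {a, b}" and cc': "c \<noteq> c'"
    and fuse: "collapses I p {s, c, c'}"
  obtains \<alpha> x \<sigma> where "x \<noteq> 0" "bij_betw \<sigma> J I"
    "\<And>r l. r \<in> J \<Longrightarrow> l \<in> I \<Longrightarrow> p r l = \<alpha> l + (if l = \<sigma> r then x else 0)"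
proof -
  from rows_around_core[OF ab core]
  obtain i j \<beta> y \<kappa> m x q where ij: "i \<in> I" "j \<in> I" "i \<noteq> j" and \<kappa>: "0 < \<kappa>" "\<kappa> < 1"
    and y: "\<And>s. s \<in> {a, b} \<Longrightarrow> y s \<noteq> 0"
    and core_rows: "\<And>s l. s \<in> {a, b} \<Longrightarrow> l \<in> I \<Longrightarrow>
       p s l = \<beta> l + (if l = i then y s else if l = j then - y s else 0)"
    and m: "m \<in> I - {j}" and x: "x \<noteq> 0" and q: "bij_betw q (J - {a, b}) (I - {j, m})"
    and rows: "\<And>c l. c \<in> J - {a, b} \<Longrightarrow> l \<in> I \<Longrightarrow>
       p c l = \<beta> l + x * (merged_unit i j \<kappa> (q c) l - merged_unit i j \<kappa> m l)"
    by (metis (no_types, lifting))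
  have mi: "m = i"
    by (rule star_centre_is_merged_column[OF ij \<kappa> y core_rows m x q rows s c c' cc' fuse])
  define \<alpha> where "\<alpha> l = \<beta> l - x * merged_unit i j \<kappa> i l" for l
  have q_in: "q r \<in> I - {i, j}" if "r \<in> J - {a, b}" for r
    using bij_betw_apply[OF q that] mi by auto
  have pc: "p r l = \<alpha> l + (if l = q r then x else 0)" if "r \<in> J - {a, b}" "l \<in> I" for r l
    using rows[OF that] q_in[OF that(1)] mi by (auto simp: \<alpha>_def merged_unit_def)
  have ps: "p r l = \<alpha> l + (if l = i then x * \<kappa> + y r else if l = j then x * (1 - \<kappa>) - y r else 0)"
    if "r \<in> {a, b}" "l \<in> I" for r l
    using core_rows[OF that] ij by (auto simp: \<alpha>_def merged_unit_def)
  have qcc': "q c \<noteq> q c'" using inj_on_eq_iff[OF bij_betw_imp_inj_on[OF q] c c'] cc' by simp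
  have one_zero: "p s i = \<alpha> i \<or> p s j = \<alpha> j"
  proof (rule ccontr)
    assume n: "\<not> ?thesis"
    have d: "distinct [i, j, q c', q c]" and four: "{i, j, q c', q c} \<subseteq> I"
      using ij q_in[OF c] q_in[OF c'] qcc' by auto
    have pci: "p c i = \<alpha> i" "p c j = \<alpha> j" using pc[OF c] ij q_in[OF c] by auto
    have psc: "p s (q c') = p c (q c')" "p s (q c) \<noteq> p c (q c)" "p c (q c') \<noteq> p c' (q c')"
      using ps[OF s] pc[OF c] pc[OF c'] q_in[OF c] q_in[OF c'] qcc' x by auto
    have moved: "\<exists>r\<in>{s, c, c'}. \<exists>r'\<in>{s, c, c'}. p r l \<noteq> p r' l" if "l \<in> {i, j, q c', q c}" for l
      using that n pci psc by auto
    show False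
      using collapses_four_moved(2)[OF fuse finite_I four d moved, of s c] n pci psc by auto
  qed
  \<comment> \<open>Name the two columns so that row \<open>s\<close> is shifted in column \<open>u\<close>.\<close>
  obtain u v where uv: "{u, v} = {i, j}" "u \<noteq> v" and sv: "p s v = \<alpha> v"
    using one_zero ij(3) by (metis insert_commute)
  have uvI: "u \<in> I" "v \<in> I" using uv(1) ij by (auto simp: doubleton_eq_iff)
  have off: "p r l = \<alpha> l" if "r \<in> {a, b}" "l \<in> I - {u, v}" for r l
    using ps[of r l] that uv(1) by auto
  have total: "p r u - \<alpha> u + (p r v - \<alpha> v) = x" if "r \<in> {a, b}" for r
  proof -
    have "p r i - \<alpha> i + (p r j - \<alpha> j) = x" using ps[OF that] ij by (simp add: algebra_simps)
    then show ?thesis using uv by (auto simp: doubleton_eq_iff)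
  qed
  have su: "p s u = \<alpha> u + x" using total[OF s] sv by simp
  obtain s' where s': "s' \<in> {a, b}" "s' \<noteq> s" "{a, b} = {s, s'}" 
    using s ab(3) by (metis insertCI insertE insert_commute singletonD)
  have q_uv: "q r \<in> I - {u, v}" if "r \<in> J - {a, b}" for r using q_in[OF that] uv(1) by blast
  have s'u: "p s' u = \<alpha> u"
  proof -
    have J: "s \<in> J" "s' \<in> J" "c \<in> J" "c' \<in> J" "s \<noteq> c" "s \<noteq> c'" "s' \<noteq> c" "s' \<noteq> c'"
      using s s'(1,2) ab c c' by auto
    have 0: "ip (\<lambda>l. p s l - p c l) (\<lambda>l. p s' l - p c' l) = 0"
      using J s'(2) cc' by (simp add: ip_linear ip_rows)
    have "ip (\<lambda>l. p s l - p c l) (\<lambda>l. p s' l - p c' l) =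
        x * (1 / k u * (p s' u - p c' u) - 1 / k (q c) * (p s' (q c) - p c' (q c)))"
      unfolding ip_def
    proof (intro weighted_inner_edge finite_I)
      show "p s l - p c l = (if l = u then x else if l = q c then - x else 0)" if "l \<in> I" for l
        using that su sv off[OF s, of l] pc[OF c, of l] q_uv[OF c] uvI uv(2) by auto
    qed (use uvI q_uv[OF c] in auto)
    moreover have "p s' (q c) = p c' (q c)" "p c' u = \<alpha> u"
      using off[OF s'(1) q_uv[OF c]] pc[OF c', of "q c"] pc[OF c', of u] q_uv[OF c] q_uv[OF c'] uvI qcc'
      by auto
    ultimately show ?thesis using 0 x k_pos[OF uvI(1)] by simp
  qed
  have s'v: "p s' v = \<alpha> v + x" using total[OF s'(1)] s'u by simp
  define \<sigma> where "\<sigma> = q(s := u, s' := v)"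
  have \<sigma>_q: "\<sigma> r = q r" if "r \<in> J - {a, b}" for r using that s s'(1) by (auto simp: \<sigma>_def)
  have "bij_betw \<sigma> (J - {a, b}) (I - {i, j})"
    using q mi bij_betw_cong[of "J - {a, b}" \<sigma> q] \<sigma>_q by (simp add: insert_commute)
  moreover have "bij_betw \<sigma> {s, s'} {u, v}"
    using s'(2) uv(2) by (auto simp: \<sigma>_def bij_betw_def)
  ultimately have "bij_betw \<sigma> ((J - {a, b}) \<union> {s, s'}) ((I - {i, j}) \<union> {u, v})"
    using uv(1) by (intro bij_betw_combine) auto
  moreover have "(J - {a, b}) \<union> {s, s'} = J" "(I - {i, j}) \<union> {u, v} = I"
    unfolding s'(3)[symmetric] uv(1) using ab ij by auto
  ultimately have bij: "bij_betw \<sigma> J I" by simp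
  show ?thesis
  proof (rule that[OF x bij])
    fix r l assume r: "r \<in> J" and l: "l \<in> I"
    consider "r = s" | "r = s'" | "r \<in> J - {a, b}" using r s'(3) by blast
    then show "p r l = \<alpha> l + (if l = \<sigma> r then x else 0)"
    proof cases
      case 1
      then show ?thesis using su sv off[OF s, of l] l s'(2) uv(2) by (auto simp: \<sigma>_def)
    next
      case 2
      then show ?thesis using s'u s'v off[OF s'(1), of l] l uv(2) by (auto simp: \<sigma>_def)
    next
      case 3
      then show ?thesis using pc[OF 3 l] \<sigma>_q by simp
    qed
  qed
qed

end

section \<open>Orthogonal families and Bose-Mesner algebras\<close>

definition orthogonal_family :: "'i set \<Rightarrow> ('i \<Rightarrow> 'a::euclidean_space) \<Rightarrow> bool" where
  "orthogonal_family I f \<longleftrightarrow>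
     finite I \<and> (\<forall>i\<in>I. f i \<noteq> 0) \<and> (\<forall>i\<in>I. \<forall>j\<in>I. i \<noteq> j \<longrightarrow> f i \<bullet> f j = 0)"

lemma orthogonal_family_independent:
  assumes "orthogonal_family I f"
  shows "inj_on f I" "independent (f ` I)" "card (f ` I) = card I"
proof -
  show inj: "inj_on f I"
    using assms unfolding orthogonal_family_def inj_on_def by (metis inner_eq_zero_iff)
  have "pairwise orthogonal (f ` I)"
    using assms unfolding orthogonal_family_def pairwise_def orthogonal_def by auto
  then show "independent (f ` I)"
    using assms by (intro pairwise_orthogonal_independent) (auto simp: orthogonal_family_def)
  show "card (f ` I) = card I" using inj by (rule card_image)
qed

lemma orthogonal_family_card_eq:
  assumes "orthogonal_family I f" "orthogonal_family K g" "span (f ` I) = span (g ` K)"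
  shows "card I = card K"
  using assms orthogonal_family_independent by (metis dim_eq_card_independent dim_span)

lemma orthogonal_family_spans:
  assumes f: "orthogonal_family I f" and g: "orthogonal_family K g"
    and sub: "g ` K \<subseteq> span (f ` I)" and card: "card I = card K"
  shows "span (g ` K) = span (f ` I)"
proof
  show "span (g ` K) \<subseteq> span (f ` I)" using sub by (simp add: span_minimal)
  have "dim (span (f ` I)) = card K"
    using orthogonal_family_independent[OF f] card by (simp add: dim_span dim_eq_card_independent)
  then show "span (f ` I) \<subseteq> span (g ` K)"
    using orthogonal_family_independent[OF g] sub
    by (intro card_ge_dim_independent[where B = "g ` K"]) auto
qed

lemma orthogonal_expansion:
  assumes f: "orthogonal_family I f" and X: "X \<in> span (f ` I)"
  shows "X = (\<Sum>i\<in>I. (X \<bullet> f i / (f i \<bullet> f i)) *\<^sub>R f i)"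
  using X
proof (induction rule: span_induct_alt)
  case base
  then show ?case by simp
next
  case (step c x y)
  then obtain j where j: "j \<in> I" "x = f j" by auto
  have "(\<Sum>i\<in>I. (f j \<bullet> f i / (f i \<bullet> f i)) *\<^sub>R f i) = (\<Sum>i\<in>I. if i = j then f j else 0)"
    using f j by (intro sum.cong) (auto simp: orthogonal_family_def)
  then have "f j = (\<Sum>i\<in>I. (f j \<bullet> f i / (f i \<bullet> f i)) *\<^sub>R f i)"
    using f j by (simp add: orthogonal_family_def)
  then have "c *\<^sub>R x + y = (\<Sum>i\<in>I. c *\<^sub>R (f j \<bullet> f i / (f i \<bullet> f i)) *\<^sub>R f i) +
      (\<Sum>i\<in>I. (y \<bullet> f i / (f i \<bullet> f i)) *\<^sub>R f i)"
    using step j by (metis scaleR_sum_right)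
  also have "\<dots> = (\<Sum>i\<in>I. ((c *\<^sub>R x + y) \<bullet> f i / (f i \<bullet> f i)) *\<^sub>R f i)"
    by (simp add: j inner_add_left add_divide_distrib scaleR_add_left sum.distrib)
  finally show ?case .
qed

lemma in_span_image_sum:
  assumes "finite I" "X \<in> span (f ` I)"
  shows "\<exists>q. X = (\<Sum>i\<in>I. q i *\<^sub>R f i)"
  using assms(2)
proof (induction rule: span_induct_alt)
  case base
  show ?case by (intro exI[of _ "\<lambda>_. 0"]) simp
next
  case (step c x y)
  then obtain j q where j: "j \<in> I" "x = f j" and q: "y = (\<Sum>i\<in>I. q i *\<^sub>R f i)" by auto
  have "(\<Sum>i\<in>I. (if i = j then c else 0) *\<^sub>R f i) = c *\<^sub>R f j"
    using j assms(1) by (simp add: if_distrib[of "\<lambda>a. a *\<^sub>R _"] cong: if_cong)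
  then have "c *\<^sub>R x + y = (\<Sum>i\<in>I. ((if i = j then c else 0) + q i) *\<^sub>R f i)"
    using j q by (simp add: scaleR_add_left sum.distrib)
  then show ?case by (rule exI[of _ "\<lambda>i. (if i = j then c else 0) + q i"])
qed

lemma linear_transpose: "linear (transpose :: real ^ 'x ^ 'y \<Rightarrow> real ^ 'y ^ 'x)"
  by (intro linearI) (simp_all add: transpose_def vec_eq_iff)

lemma linear_matrix_mult:
  shows "linear (\<lambda>X :: real ^ 'x ^ 'x. X ** Y)" "linear (\<lambda>X :: real ^ 'x ^ 'x. Y ** X)"
  by (intro linearI;
      simp add: matrix_matrix_mult_def vec_eq_iff sum.distrib sum_distrib_left algebra_simps)+

lemma inner_eq_trace:
  fixes X Y :: "real ^ 'x ^ 'x"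
  assumes "transpose Y = Y"
  shows "X \<bullet> Y = trace (X ** Y)"
proof -
  have "Y $ i $ j = Y $ j $ i" for i j
    using arg_cong[OF assms, of "\<lambda>M. M $ i $ j"] by (simp add: transpose_def)
  then show ?thesis by (simp add: inner_vec_def trace_def matrix_matrix_mult_def)
qed

lemma span_closed_under_matrix_mult:
  fixes S :: "(real ^ 'x ^ 'x) set"
  assumes S: "\<And>X Y. X \<in> S \<Longrightarrow> Y \<in> S \<Longrightarrow> X ** Y \<in> span S" and XY: "X \<in> span S" "Y \<in> span S"
  shows "X ** Y \<in> span S"
proof -
  have 1: "X ** Y \<in> span S" if X: "X \<in> S" for X
  proof -
    have "subspace {Y. X ** Y \<in> span S}"
      using linear_subspace_vimage[OF linear_matrix_mult(2) subspace_span] by (simp add: vimage_def)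
    then show ?thesis using span_induct[OF XY(2), of "\<lambda>Y. X ** Y \<in> span S"] S X by auto
  qed
  have "subspace {X. X ** Y \<in> span S}"
    using linear_subspace_vimage[OF linear_matrix_mult(1) subspace_span] by (simp add: vimage_def)
  then show ?thesis using span_induct[OF XY(1), of "\<lambda>X. X ** Y \<in> span S"] 1 by auto
qed

text \<open>
  The index set is left arbitrary so that the facts apply both to a scheme and to its fusions, which
  are indexed by blocks.
\<close>

context
  fixes I :: "'i set" and e :: 'i and A :: "'i \<Rightarrow> real ^ 'x ^ 'x"
  assumes scheme: "symmetric_association_scheme I e A"
begin

lemma scheme_finite: "finite I" and scheme_unit: "e \<in> I" "A e = mat 1"
  and scheme_sum: "(\<Sum>i\<in>I. A i) = all_ones"
  using scheme by (auto simp: symmetric_association_scheme_def)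

lemma scheme_disjoint:
  assumes ij: "i \<in> I" "j \<in> I" "i \<noteq> j"
  shows "A i $ x $ y = 0 \<or> A j $ x $ y = 0"
proof (rule ccontr)
  assume n: "\<not> ?thesis"
  have 01: "A h $ x $ y \<in> {0, 1}" if "h \<in> I" for h
    using scheme that by (auto simp: symmetric_association_scheme_def)
  have "(\<Sum>h\<in>{i, j}. A h $ x $ y) \<le> (\<Sum>h\<in>I. A h $ x $ y)"
    using scheme_finite ij 01 by (intro sum_mono2) force+
  also have "\<dots> = (\<Sum>h\<in>I. A h) $ x $ y" by simp
  also have "\<dots> = 1" using scheme_sum by (simp add: all_ones_def)
  finally show False using n 01[OF ij(1)] 01[OF ij(2)] ij by auto
qed

lemma scheme_orthogonal_family: "orthogonal_family I A"
proof -
  have "A i \<bullet> A j = 0" if "i \<in> I" "j \<in> I" "i \<noteq> j" for i j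
    using scheme_disjoint[OF that] unfolding inner_vec_def by (intro sum.neutral ballI) auto
  then show ?thesis using scheme scheme_finite
    by (auto simp: orthogonal_family_def symmetric_association_scheme_def)
qed

lemma bose_mesner_mult:
  assumes "X \<in> bose_mesner I A" "Y \<in> bose_mesner I A"
  shows "X ** Y \<in> bose_mesner I A"
  unfolding bose_mesner_def
proof (rule span_closed_under_matrix_mult)
  fix X Y assume "X \<in> A ` I" "Y \<in> A ` I"
  then obtain i j where ij: "i \<in> I" "j \<in> I" "X = A i" "Y = A j" by auto
  obtain p where "\<forall>i\<in>I. \<forall>j\<in>I. A i ** A j = (\<Sum>h\<in>I. p i j h *\<^sub>R A h)"
    using scheme unfolding symmetric_association_scheme_def by blast
  then have "X ** Y = (\<Sum>h\<in>I. p i j h *\<^sub>R A h)" using ij by blast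
  then show "X ** Y \<in> span (A ` I)" by (auto intro: span_sum span_scale span_base)
qed (use assms in \<open>simp_all add: bose_mesner_def\<close>)

lemma bose_mesner_symmetric:
  assumes "X \<in> bose_mesner I A"
  shows "transpose X = X"
proof -
  have "subspace {X. transpose X = (X :: real ^ 'x ^ 'x)}"
    by (auto simp: subspace_def linear_add[OF linear_transpose] linear_scale[OF linear_transpose]
        linear_0[OF linear_transpose])
  then show ?thesis
    using span_induct[of X "A ` I" "\<lambda>X. transpose X = X"] assms scheme
    by (auto simp: bose_mesner_def symmetric_association_scheme_def)
qed

lemma bose_mesner_commute:
  assumes "X \<in> bose_mesner I A" "Y \<in> bose_mesner I A"
  shows "X ** Y = Y ** X"
  using assms bose_mesner_symmetric bose_mesner_mult by (metis matrix_transpose_mul)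

lemma all_ones_in_bose_mesner: "all_ones \<in> bose_mesner I A"
  unfolding scheme_sum[symmetric] bose_mesner_def by (intro span_sum span_base) auto

lemma mat_1_in_bose_mesner: "mat 1 \<in> bose_mesner I A"
  using scheme_unit unfolding bose_mesner_def by (metis imageI span_base)

lemma all_ones_inner: "i \<in> I \<Longrightarrow> all_ones \<bullet> A i = A i \<bullet> A i"
proof -
  assume i: "i \<in> I"
  have "all_ones \<bullet> A i = (\<Sum>j\<in>I. A j \<bullet> A i)" by (simp add: scheme_sum[symmetric] inner_sum_left)
  also have "\<dots> = (\<Sum>j\<in>I. if j = i then A i \<bullet> A i else 0)"
    using scheme_orthogonal_family i by (intro sum.cong) (auto simp: orthogonal_family_def)
  finally show ?thesis using i scheme_finite by simp
qed

text \<open>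
  The product of the two idempotents is an idempotent of the commutative algebra below both, so if it
  is nonzero, it equals both.
\<close>

lemma minimal_idempotents_orthogonal:
  assumes "E \<in> minimal_idempotents (bose_mesner I A)" "F \<in> minimal_idempotents (bose_mesner I A)"
    and "E \<noteq> F"
  shows "E ** F = 0"
proof (rule ccontr)
  assume n: "E ** F \<noteq> 0"
  note E = assms(1)[unfolded minimal_idempotents_def, simplified]
  note F = assms(2)[unfolded minimal_idempotents_def, simplified]
  have c: "F ** E = E ** F" using bose_mesner_commute E F by blast
  have "E ** F \<in> bose_mesner I A" using bose_mesner_mult E F by blast
  moreover have "E ** (E ** F) = E ** F" "(E ** F) ** F = E ** F"
    using E F by (metis matrix_mul_assoc)+
  moreover from this c have "(E ** F) ** E = E ** F" "F ** (E ** F) = E ** F"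
    by (metis matrix_mul_assoc)+
  moreover from calculation have "(E ** F) ** (E ** F) = E ** F"
    by (metis matrix_mul_assoc)
  ultimately have "E ** F = E" "E ** F = F" using E F n by blast+
  then show False using assms(3) by simp
qed

end

section \<open>Eigenvalues of a labelled scheme\<close>

locale labelled_scheme =
  fixes d :: nat and A E :: "nat \<Rightarrow> real ^ 'x ^ 'x"
  assumes d: "2 \<le> d" and scheme: "symmetric_association_scheme {0..d} 0 A"
    and labelling: "idempotent_labelling d A E"
begin

lemma E_minimal: "j \<le> d \<Longrightarrow> E j \<in> minimal_idempotents (bose_mesner {0..d} A)"
  using labelling by (auto simp: idempotent_labelling_def bij_betw_def)

lemma E_in: "j \<le> d \<Longrightarrow> E j \<in> bose_mesner {0..d} A" and E_idem: "j \<le> d \<Longrightarrow> E j ** E j = E j"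
  and E_nonzero: "j \<le> d \<Longrightarrow> E j \<noteq> 0"
  using E_minimal by (auto simp: minimal_idempotents_def)

lemma E_inj: "inj_on E {0..d}"
  using labelling by (auto simp: idempotent_labelling_def bij_betw_def)

lemma E_mult: "i \<le> d \<Longrightarrow> j \<le> d \<Longrightarrow> E i ** E j = (if i = j then E i else 0)"
  using E_idem minimal_idempotents_orthogonal[OF scheme E_minimal E_minimal] E_inj
  by (auto simp: inj_on_eq_iff)

lemma E_inner: "i \<le> d \<Longrightarrow> j \<le> d \<Longrightarrow> E i \<bullet> E j = (if i = j then trace (E i) else 0)"
  using inner_eq_trace[OF bose_mesner_symmetric[OF scheme E_in]] E_mult by (auto simp: trace_def)

lemma E_norm_pos: "j \<le> d \<Longrightarrow> 0 < E j \<bullet> E j"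
  using E_nonzero by simp

lemma E_orthogonal_family: "orthogonal_family {0..d} E"
  using E_nonzero E_inner by (auto simp: orthogonal_family_def)

text \<open>
  The labelling provides as many pairwise orthogonal elements of the algebra as there are relations,
  and this is the dimension.
\<close>

lemma bose_mesner_eq_span_E: "bose_mesner {0..d} A = span (E ` {0..d})"
proof -
  have "E ` {0..d} \<subseteq> span (A ` {0..d})" using E_in by (auto simp: bose_mesner_def)
  then show ?thesis
    using orthogonal_family_spans[OF scheme_orthogonal_family[OF scheme] E_orthogonal_family]
    by (simp add: bose_mesner_def)
qed

definition eigenvalue :: "real ^ 'x ^ 'x \<Rightarrow> nat \<Rightarrow> real" where
  "eigenvalue X j = X \<bullet> E j / (E j \<bullet> E j)"

text \<open>
  The inverse of \<open>eigenvalue\<close>: it turns the pointwise operations on functions on \<open>{0..d}\<close> into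
  the operations of the Bose-Mesner algebra.
\<close>

definition spectral :: "(nat \<Rightarrow> real) \<Rightarrow> real ^ 'x ^ 'x" where
  "spectral f = (\<Sum>j\<in>{0..d}. f j *\<^sub>R E j)"

lemma spectral_eigenvalue: "X \<in> bose_mesner {0..d} A \<Longrightarrow> spectral (eigenvalue X) = X"
  using orthogonal_expansion[OF E_orthogonal_family, of X] bose_mesner_eq_span_E
  by (simp add: spectral_def eigenvalue_def)

lemma eigenvalue_spectral:
  assumes j: "j \<le> d"
  shows "eigenvalue (spectral f) j = f j"
proof -
  have "spectral f \<bullet> E j = (\<Sum>i\<in>{0..d}. if i = j then f j * (E j \<bullet> E j) else 0)"
    unfolding spectral_def inner_sum_left using j E_inner by (intro sum.cong) auto
  then show ?thesis using j E_nonzero by (simp add: eigenvalue_def)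
qed

lemma spectral_mult: "spectral f ** spectral g = spectral (\<lambda>j. f j * g j)"
proof -
  have right: "X ** spectral g = (\<Sum>j\<in>{0..d}. g j *\<^sub>R (X ** E j))" for X :: "real ^ 'x ^ 'x"
    by (simp add: spectral_def linear_sum[OF linear_matrix_mult(2)] linear_scale[OF linear_matrix_mult(2)])
  have left: "spectral f ** Y = (\<Sum>i\<in>{0..d}. f i *\<^sub>R (E i ** Y))" for Y :: "real ^ 'x ^ 'x"
    by (simp add: spectral_def linear_sum[OF linear_matrix_mult(1)] linear_scale[OF linear_matrix_mult(1)])
  have "spectral f ** spectral g =
      (\<Sum>i\<in>{0..d}. \<Sum>j\<in>{0..d}. (f i * g j) *\<^sub>R (E i ** E j))"
    by (simp only: left) (simp add: right scaleR_sum_right)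
  also have "\<dots> = (\<Sum>i\<in>{0..d}. \<Sum>j\<in>{0..d}. if j = i then (f i * g i) *\<^sub>R E i else 0)"
    using E_mult by (intro sum.cong) auto
  finally show ?thesis by (simp add: spectral_def)
qed

lemma spectral_linear:
  "spectral (\<lambda>j. f j + g j) = spectral f + spectral g" "spectral (\<lambda>j. c * f j) = c *\<^sub>R spectral f"
  by (simp_all add: spectral_def scaleR_add_left sum.distrib scaleR_sum_right)

lemma eigenvalue_linear:
  "eigenvalue (X + Y) j = eigenvalue X j + eigenvalue Y j"
  "eigenvalue (c *\<^sub>R X) j = c * eigenvalue X j"
  "eigenvalue (\<Sum>i\<in>S. F i) j = (\<Sum>i\<in>S. eigenvalue (F i) j)"
  by (simp_all add: eigenvalue_def inner_add_left add_divide_distrib inner_sum_left sum_divide_distrib)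

lemma eigenvalue_E: "i \<le> d \<Longrightarrow> j \<le> d \<Longrightarrow> eigenvalue (E i) j = (if i = j then 1 else 0)"
  using E_orthogonal_family by (auto simp: eigenvalue_def orthogonal_family_def)

lemma eigenvalue_mat_1: "j \<le> d \<Longrightarrow> eigenvalue (mat 1) j = 1"
proof -
  assume j: "j \<le> d"
  have "mat 1 \<bullet> E j = E j \<bullet> E j"
    using inner_eq_trace[OF bose_mesner_symmetric[OF scheme E_in[OF j]], of "mat 1"] E_inner j by simp
  then show ?thesis using E_norm_pos[OF j] by (simp add: eigenvalue_def)
qed

lemma all_ones_eq: "all_ones = real CARD('x) *\<^sub>R E 0"
  using labelling by (simp add: idempotent_labelling_def)

lemma eigenvalue_all_ones: "j \<le> d \<Longrightarrow> eigenvalue all_ones j = (if j = 0 then real CARD('x) else 0)"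
  using eigenvalue_E[of 0 j] by (simp add: all_ones_eq eigenvalue_linear)

lemma mat_1_eq: "mat 1 = spectral (\<lambda>_. 1)"
proof -
  have "mat 1 = spectral (eigenvalue (mat 1))"
    by (simp add: spectral_eigenvalue mat_1_in_bose_mesner[OF scheme])
  also have "\<dots> = spectral (\<lambda>_. 1)"
    unfolding spectral_def by (intro sum.cong) (auto simp: eigenvalue_mat_1)
  finally show ?thesis .
qed

lemma A_in: "i \<le> d \<Longrightarrow> A i \<in> bose_mesner {0..d} A"
  by (auto simp: bose_mesner_def intro: span_base)

text \<open>
  A relation with a constant column would be a combination of \<open>J\<close> and \<open>I\<close>. As there are at least two
  nonidentity relations, orthogonality to another one makes the coefficient of \<open>J\<close> vanish, and
  orthogonality to \<open>I\<close> the other one.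
\<close>

lemma eigenvalue_column_moved:
  assumes i: "i \<in> {1..d}"
  shows "\<exists>r\<in>{1..d}. \<exists>s\<in>{1..d}. eigenvalue (A i) r \<noteq> eigenvalue (A i) s"
proof (rule ccontr)
  assume n: "\<not> ?thesis"
  have "1 \<in> {1..d}" using d by simp
  then have const: "eigenvalue (A i) r = eigenvalue (A i) 1" if "r \<in> {1..d}" for r
    using n that by blast
  define t where "t = eigenvalue (A i) 1"
  define c where "c = (eigenvalue (A i) 0 - t) / real CARD('x)"
  have "A i = spectral (eigenvalue (A i))" using i by (simp add: spectral_eigenvalue A_in)
  also have "\<dots> = spectral (eigenvalue (c *\<^sub>R all_ones + t *\<^sub>R mat 1))"
    unfolding spectral_def
  proof (intro sum.cong refl)
    fix j assume j: "j \<in> {0..d}"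
    have "eigenvalue (A i) j = eigenvalue (c *\<^sub>R all_ones + t *\<^sub>R mat 1) j"
      using j const[of j]
      by (cases "j = 0") (auto simp: eigenvalue_linear eigenvalue_mat_1 eigenvalue_all_ones c_def t_def)
    then show "eigenvalue (A i) j *\<^sub>R E j = eigenvalue (c *\<^sub>R all_ones + t *\<^sub>R mat 1) j *\<^sub>R E j"
      by simp
  qed
  also have "\<dots> = c *\<^sub>R all_ones + t *\<^sub>R mat 1"
    using all_ones_in_bose_mesner[OF scheme] mat_1_in_bose_mesner[OF scheme]
    by (intro spectral_eigenvalue) (auto simp: bose_mesner_def intro: span_add span_scale)
  finally have Ai: "A i = c *\<^sub>R all_ones + t *\<^sub>R A 0" by (simp add: scheme_unit[OF scheme])
  have orth: "A h \<bullet> A h' = 0" if "h \<le> d" "h' \<le> d" "h \<noteq> h'" for h h'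
    using scheme_orthogonal_family[OF scheme] that by (auto simp: orthogonal_family_def)
  have pos: "A h \<bullet> A h \<noteq> 0" if "h \<le> d" for h
    using scheme_orthogonal_family[OF scheme] that by (auto simp: orthogonal_family_def)
  have J: "all_ones \<bullet> A h = A h \<bullet> A h" if "h \<le> d" for h
    using all_ones_inner[OF scheme] that by simp
  obtain h where h: "h \<in> {1..d}" "h \<noteq> i"
  proof (cases "i = 1")
    case True then show ?thesis using that[of 2] d by simp
  next
    case False then show ?thesis using that[of 1] d by simp
  qed
  have "A i \<bullet> A h = 0" using orth[of i h] h i by simp
  then have "c * (A h \<bullet> A h) = 0" using orth[of 0 h] h J[of h] by (simp add: Ai inner_add_left)
  then have "c = 0" using pos[of h] h by simp
  then have "t * (A 0 \<bullet> A 0) = 0" using orth[of i 0] i Ai by (simp add: inner_add_left)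
  then have "t = 0" using pos[of 0] by simp
  then show False using Ai \<open>c = 0\<close> pos[of i] i by simp
qed

definition valency :: "nat \<Rightarrow> real" where
  "valency i = (A i \<bullet> A i) / real CARD('x)"

text \<open>
  The multiplicity, that is, the rank of \<open>E j\<close>, is the trace of \<open>E j\<close>, and this is \<open>E j \<bullet> E j\<close>.
\<close>

definition size_over_multiplicity :: "nat \<Rightarrow> real" where
  "size_over_multiplicity j = real CARD('x) / (E j \<bullet> E j)"

text \<open>
  Expand \<open>E r\<close> in the orthogonal basis of the \<open>A i\<close> and take the product with \<open>E s\<close>. The identity relation
  contributes the term 1 that moves to the right-hand side.
\<close>

lemma eigenvalue_rows_orthogonal:
  assumes r: "r \<in> {1..d}" and s: "s \<in> {1..d}"
  shows "(\<Sum>i\<in>{1..d}. 1 / valency i * eigenvalue (A i) r * eigenvalue (A i) s) =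
    (if r = s then size_over_multiplicity r else 0) - 1"
proof -
  define e where "e j = E j \<bullet> E j" for j
  let ?n = "real CARD('x)"
  let ?p = "\<lambda>i j. eigenvalue (A i) j"
  have e: "e r \<noteq> 0" "e s \<noteq> 0" using r s E_norm_pos[of r] E_norm_pos[of s] by (auto simp: e_def)
  have p: "E j \<bullet> A i = ?p i j * e j" if "e j \<noteq> 0" for i j
    using that by (simp add: eigenvalue_def e_def inner_commute)
  have "E r \<in> span (A ` {0..d})" using E_in[of r] r by (simp add: bose_mesner_def)
  from orthogonal_expansion[OF scheme_orthogonal_family[OF scheme] this]
  have "E r \<bullet> E s = (\<Sum>i\<in>{0..d}. (E r \<bullet> A i / (A i \<bullet> A i)) *\<^sub>R A i) \<bullet> E s"
    by (rule arg_cong)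
  also have "\<dots> = (\<Sum>i\<in>{0..d}. (E r \<bullet> A i / (A i \<bullet> A i)) * (A i \<bullet> E s))"
    by (simp add: inner_sum_left)
  also have "\<dots> = (\<Sum>i\<in>{0..d}. e r * e s / ?n * (1 / valency i * ?p i r * ?p i s))"
    by (intro sum.cong) (auto simp: p[OF e(1)] p[OF e(2)] inner_commute[of _ "E s"] valency_def)
  also have "\<dots> = e r * e s / ?n * (\<Sum>i\<in>{0..d}. 1 / valency i * ?p i r * ?p i s)"
    by (simp add: sum_distrib_left)
  finally have "(\<Sum>i\<in>{0..d}. 1 / valency i * ?p i r * ?p i s) = ?n * (E r \<bullet> E s) / (e r * e s)"
    using e by (simp add: field_simps)
  also have "\<dots> = (if r = s then size_over_multiplicity r else 0)"
    using e r s E_orthogonal_family by (auto simp: orthogonal_family_def e_def size_over_multiplicity_def)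
  finally have "(\<Sum>i\<in>{0..d}. 1 / valency i * ?p i r * ?p i s) = (if r = s then size_over_multiplicity r else 0)" .
  moreover have "{0..d} = insert 0 {1..d}" by auto
  moreover have "valency 0 = 1"
  proof -
    have "A 0 \<bullet> A 0 = trace (mat 1 :: real ^ 'x ^ 'x)"
      unfolding scheme_unit[OF scheme] by (subst inner_eq_trace) (simp_all add: transpose_mat)
    then show ?thesis by (simp add: valency_def trace_I)
  qed
  moreover have "?p 0 r = 1" "?p 0 s = 1"
    using r s eigenvalue_mat_1 by (simp_all add: scheme_unit[OF scheme])
  ultimately show ?thesis by simp
qed

lemma eigenvalue_rows_axioms:
  assumes "5 \<le> d"
  shows "eigenvalue_rows {1..d} {1..d} (\<lambda>j i. eigenvalue (A i) j) valency size_over_multiplicity"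
proof
  show "0 < valency i" if "i \<in> {1..d}" for i
    using that scheme_orthogonal_family[OF scheme] by (simp add: valency_def orthogonal_family_def)
  show "0 < size_over_multiplicity r" if "r \<in> {1..d}" for r
    using that E_norm_pos[of r] by (simp add: size_over_multiplicity_def)
  show "(\<Sum>i\<in>{1..d}. eigenvalue (A i) r) = - 1" if r: "r \<in> {1..d}" for r
  proof -
    have "0 = eigenvalue all_ones r" using r eigenvalue_all_ones[of r] by simp
    also have "\<dots> = (\<Sum>i\<in>{0..d}. eigenvalue (A i) r)"
      by (simp add: scheme_sum[OF scheme, symmetric] eigenvalue_linear)
    also have "{0..d} = insert 0 {1..d}" by auto
    finally show ?thesis using r eigenvalue_mat_1[of r] by (simp add: scheme_unit[OF scheme])
  qed
qed (use assms eigenvalue_rows_orthogonal eigenvalue_column_moved in auto)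

section \<open>Fusing idempotents merge rows\<close>

lemma block_sum_spectral:
  assumes "C \<subseteq> {0..d}"
  shows "block_sum E C = spectral (\<lambda>j. of_bool (j \<in> C))"
proof -
  have "spectral (\<lambda>j. of_bool (j \<in> C)) = (\<Sum>j\<in>{0..d}. if j \<in> C then E j else 0)"
    unfolding spectral_def by (intro sum.cong) auto
  also have "\<dots> = (\<Sum>j\<in>{0..d} \<inter> C. E j)" by (simp add: sum.inter_restrict)
  also have "{0..d} \<inter> C = C" using assms by auto
  finally show ?thesis by (simp add: block_sum_def)
qed

lemma fused_bose_mesner_subset:
  assumes "is_fusion_scheme d A \<pi>"
  shows "bose_mesner \<pi> (block_sum A) \<subseteq> bose_mesner {0..d} A"
proof -
  have "block_sum A B \<in> span (A ` {0..d})" if "B \<in> \<pi>" for B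
    using that assms unfolding block_sum_def is_fusion_scheme_def pointed_partition_def partition_on_def
    by (intro span_sum span_base) auto
  then show ?thesis unfolding bose_mesner_def by (intro span_minimal) auto
qed

text \<open>
  If \<open>X\<close> took two values on \<open>C\<close>, Lagrange interpolation in \<open>X\<close>, multiplied by the idempotent of \<open>C\<close>, would
  yield the sum of the \<open>E j\<close> with \<open>j\<close> in \<open>C\<close> on which \<open>X\<close> has the same eigenvalue as on \<open>E a\<close>. This idempotent
  belongs to the fused algebra and lies strictly between 0 and the minimal idempotent of \<open>C\<close>.
\<close>

lemma eigenvalue_constant_on_minimal_block:
  assumes \<pi>: "is_fusion_scheme d A \<pi>" and C: "C \<subseteq> {0..d}"
    and min: "block_sum E C \<in> minimal_idempotents (bose_mesner \<pi> (block_sum A))"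
    and X: "X \<in> bose_mesner \<pi> (block_sum A)" and ab: "a \<in> C" "b \<in> C"
  shows "eigenvalue X a = eigenvalue X b"
proof (rule ccontr)
  assume ne: "eigenvalue X a \<noteq> eigenvalue X b"
  let ?B = "bose_mesner \<pi> (block_sum A)"
  let ?x = "eigenvalue X"
  have fusion: "symmetric_association_scheme \<pi> {0} (block_sum A)"
    using \<pi> by (simp add: is_fusion_scheme_def)
  have B_comb: "u *\<^sub>R Y + v *\<^sub>R Z \<in> ?B" if "Y \<in> ?B" "Z \<in> ?B" for u v Y Z
    using that by (simp add: bose_mesner_def span_add span_scale)
  have x_in: "spectral (\<lambda>j. u * ?x j + v * 1) \<in> ?B" for u v
    unfolding spectral_linear mat_1_eq[symmetric]
    using X spectral_eigenvalue fused_bose_mesner_subset[OF \<pi>] mat_1_in_bose_mesner[OF fusion]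
    by (intro B_comb) auto
  \<comment> \<open>The Lagrange polynomial in \<open>X\<close> that is 1 at the eigenvalue of \<open>a\<close> and 0 on \<open>L\<close>.\<close>
  have prod_in: "spectral (\<lambda>j. \<Prod>l\<in>L. (?x j - l) / (?x a - l)) \<in> ?B" if "finite L" for L
    using that
  proof (induction L rule: finite_induct)
    case empty
    then show ?case using mat_1_in_bose_mesner[OF fusion] by (simp add: mat_1_eq)
  next
    case (insert l L)
    have "(\<lambda>j. (?x j - l) / (?x a - l)) = (\<lambda>j. 1 / (?x a - l) * ?x j + (- l / (?x a - l)) * 1)"
      by (simp add: diff_divide_distrib)
    then have "spectral (\<lambda>j. (?x j - l) / (?x a - l)) \<in> ?B" using x_in by presburger
    then have "spectral (\<lambda>j. (?x j - l) / (?x a - l)) **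
        spectral (\<lambda>j. \<Prod>l\<in>L. (?x j - l) / (?x a - l)) \<in> ?B"
      using insert.IH by (intro bose_mesner_mult[OF fusion])
    then show ?case using insert.hyps by (simp add: spectral_mult)
  qed
  define L where "L = ?x ` C - {?x a}"
  have L: "finite L" using C by (auto simp: L_def intro: finite_subset)
  define h where "h j = of_bool (j \<in> C) * (\<Prod>l\<in>L. (?x j - l) / (?x a - l))" for j
  have h: "h j = of_bool (j \<in> C \<and> ?x j = ?x a)" for j
  proof (cases "j \<in> C")
    case True
    show ?thesis
    proof (cases "?x j = ?x a")
      case same: True
      have "(\<Prod>l\<in>L. (?x j - l) / (?x a - l)) = 1"
        using same by (intro prod.neutral) (auto simp: L_def)
      then show ?thesis using True same by (simp add: h_def)
    next
      case False
      then have "?x j \<in> L" using True by (simp add: L_def)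
      then have "(\<Prod>l\<in>L. (?x j - l) / (?x a - l)) = 0" using L by (intro prod_zero) auto
      then show ?thesis using False by (simp add: h_def)
    qed
  qed (simp add: h_def)
  have EC: "block_sum E C \<in> ?B" using min by (simp add: minimal_idempotents_def)
  have "block_sum E C ** spectral (\<lambda>j. \<Prod>l\<in>L. (?x j - l) / (?x a - l)) \<in> ?B"
    using bose_mesner_mult[OF fusion EC prod_in[OF L]] .
  then have "spectral h \<in> ?B" unfolding block_sum_spectral[OF C] spectral_mult h_def .
  moreover have "spectral h ** spectral h = spectral h" "block_sum E C ** spectral h = spectral h"
    "spectral h ** block_sum E C = spectral h"
    unfolding block_sum_spectral[OF C] spectral_mult h
    by (intro arg_cong[of _ _ spectral] ext; simp)+
  ultimately have "spectral h = 0 \<or> spectral h = block_sum E C"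
    using min by (auto simp: minimal_idempotents_def)
  moreover have "a \<le> d" "b \<le> d" using C ab by auto
  ultimately show False
    using eigenvalue_spectral[of a h] eigenvalue_spectral[of b h]
      eigenvalue_spectral[of b "\<lambda>j. of_bool (j \<in> C)"] ab ne
    unfolding block_sum_spectral[OF C] by (auto simp: h eigenvalue_def)
qed

lemma block_sum_E_orthogonal_family:
  assumes \<rho>: "partition_on {0..d} \<rho>"
  shows "orthogonal_family \<rho> (block_sum E)"
  unfolding orthogonal_family_def
proof (intro conjI ballI impI)
  show "finite \<rho>" using \<rho> by (rule finite_elements[rotated]) simp
  have sub: "C \<subseteq> {0..d}" if "C \<in> \<rho>" for C using \<rho> that by (auto simp: partition_on_def)
  show "block_sum E C \<noteq> 0" if C: "C \<in> \<rho>" for C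
  proof
    assume 0: "block_sum E C = 0"
    obtain j where j: "j \<in> C" using \<rho> C by (metis partition_onD3 all_not_in_conv)
    then have "eigenvalue (block_sum E C) j = 1"
      using sub[OF C] by (subst block_sum_spectral) (auto simp: eigenvalue_spectral)
    then show False by (simp add: 0 eigenvalue_def)
  qed
  show "block_sum E C \<bullet> block_sum E D = 0" if "C \<in> \<rho>" "D \<in> \<rho>" "C \<noteq> D" for C D
  proof -
    have "C \<inter> D = {}" using \<rho> that by (auto simp: partition_on_def disjoint_def)
    moreover have "block_sum E C \<bullet> block_sum E D = (\<Sum>i\<in>C. \<Sum>j\<in>D. E i \<bullet> E j)"
      unfolding block_sum_def inner_sum_left by (intro sum.cong refl inner_sum_right)
    moreover have "E i \<bullet> E j = 0" if ij: "i \<in> C" "j \<in> D" for i j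
    proof -
      have "i \<noteq> j" "i \<in> {0..d}" "j \<in> {0..d}"
        using ij \<open>C \<inter> D = {}\<close> sub[OF \<open>C \<in> \<rho>\<close>] sub[OF \<open>D \<in> \<rho>\<close>] by blast+
      then show ?thesis using E_orthogonal_family by (simp add: orthogonal_family_def)
    qed
    ultimately show ?thesis by (simp add: sum.neutral)
  qed
qed

text \<open>
  The elements of the fused algebra are constant on the blocks of idempotents, so the algebra is spanned by
  the merged idempotents. It is also spanned by the merged relations, and comparing dimensions
  shows that there are \<open>d - 1\<close> blocks of relations. One of them is \<open>{0}\<close>, which leaves \<open>d - 2\<close> blocks of
  \<open>{1..d}\<close>. The sum of a row over a block is an eigenvalue of the merged relation.
\<close>

lemma fusing_idempotents_collapse:
  assumes fuse: "idempotents_fuse d A E R" and R: "card R = 3"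
  shows "collapses {1..d} (\<lambda>j i. eigenvalue (A i) j) R"
proof -
  define \<rho> where "\<rho> = insert R ((\<lambda>j. {j}) ` ({0..d} - R))"
  obtain \<pi> where Rd: "R \<subseteq> {1..d}" and \<pi>: "is_fusion_scheme d A \<pi>" and \<rho>: "partition_on {0..d} \<rho>"
    and min: "minimal_idempotents (bose_mesner \<pi> (block_sum A)) = block_sum E ` \<rho>"
    using fuse unfolding idempotents_fuse_def idempotent_partition_def pointed_partition_def \<rho>_def
    by blast
  let ?B = "bose_mesner \<pi> (block_sum A)"
  have fusion: "symmetric_association_scheme \<pi> {0} (block_sum A)" and \<pi>0: "{0} \<in> \<pi>"
    and part: "partition_on {0..d} \<pi>"
    using \<pi> by (auto simp: is_fusion_scheme_def pointed_partition_def)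
  have \<rho>_sub: "C \<subseteq> {0..d}" if "C \<in> \<rho>" for C using \<rho> that by (auto simp: partition_on_def)
  have const: "eigenvalue X a = eigenvalue X b" if "X \<in> ?B" "C \<in> \<rho>" "a \<in> C" "b \<in> C" for X C a b
    using eigenvalue_constant_on_minimal_block[OF \<pi> \<rho>_sub[OF that(2)] _ that(1,3,4)] min that(2) by blast
  have "X \<in> span (block_sum E ` \<rho>)" if X: "X \<in> ?B" for X
  proof -
    have "X = spectral (eigenvalue X)"
      using X fused_bose_mesner_subset[OF \<pi>] by (auto simp: spectral_eigenvalue)
    also have "\<dots> = (\<Sum>C\<in>\<rho>. \<Sum>j\<in>C. eigenvalue X j *\<^sub>R E j)"
    proof -
      have "{0..d} = \<Union>\<rho>" using \<rho> by (simp add: partition_on_def)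
      moreover have "sum (\<lambda>j. eigenvalue X j *\<^sub>R E j) (\<Union>\<rho>) = (\<Sum>C\<in>\<rho>. \<Sum>j\<in>C. eigenvalue X j *\<^sub>R E j)"
        using \<rho> \<rho>_sub by (subst sum.Union_disjoint)
          (auto simp: partition_on_def disjoint_def intro: finite_subset)
      ultimately show ?thesis by (simp add: spectral_def)
    qed
    also have "\<dots> \<in> span (block_sum E ` \<rho>)"
    proof (rule span_sum)
      fix C assume C: "C \<in> \<rho>"
      then obtain a where a: "a \<in> C" using \<rho> by (metis partition_onD3 all_not_in_conv)
      have "(\<Sum>j\<in>C. eigenvalue X j *\<^sub>R E j) = eigenvalue X a *\<^sub>R block_sum E C"
        unfolding block_sum_def scaleR_sum_right using const[OF X C _ a] by (intro sum.cong) auto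
      then show "(\<Sum>j\<in>C. eigenvalue X j *\<^sub>R E j) \<in> span (block_sum E ` \<rho>)"
        using C by (auto intro: span_scale span_base)
    qed
    finally show ?thesis .
  qed
  moreover have "block_sum E ` \<rho> \<subseteq> ?B" using min by (auto simp: minimal_idempotents_def)
  ultimately have "?B \<subseteq> span (block_sum E ` \<rho>)" "span (block_sum E ` \<rho>) \<subseteq> ?B"
    unfolding bose_mesner_def by (blast, intro span_minimal subspace_span)
  then have "span (block_sum A ` \<pi>) = span (block_sum E ` \<rho>)"
    unfolding bose_mesner_def by (rule subset_antisym)
  then have "card \<pi> = card \<rho>"
    by (intro orthogonal_family_card_eq[OF scheme_orthogonal_family[OF fusion]
          block_sum_E_orthogonal_family[OF \<rho>]])
  also have "card \<rho> = d - 1"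
  proof -
    have fR: "finite R" using Rd finite_subset by blast
    have "R \<notin> (\<lambda>j. {j}) ` ({0..d} - R)" using R by auto
    moreover have "card ((\<lambda>j. {j}) ` ({0..d} - R)) = d + 1 - 3"
    proof -
      have "R \<subseteq> {0..d}" using Rd by auto
      then have "card ({0..d} - R) = d + 1 - 3" using R fR by (simp add: card_Diff_subset)
      then show ?thesis by (subst card_image) auto
    qed
    moreover have "3 \<le> d" using card_mono[OF _ Rd] R by simp
    ultimately show ?thesis by (simp add: \<rho>_def)
  qed
  finally have card_\<pi>: "card \<pi> = d - 1" .
  have "3 \<le> d" using card_mono[OF _ Rd] R by simp
  have disj: "0 \<notin> B" if "B \<in> \<pi> - {{0}}" for B
    using disjointD[OF partition_onD2[OF part] _ \<pi>0, of B] that by auto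
  have "partition_on {1..d} (\<pi> - {{0}})"
  proof (rule partition_onI)
    have U: "\<Union>\<pi> = {0..d}" using part by (simp add: partition_on_def)
    show "\<Union> (\<pi> - {{0}}) = {1..d}"
    proof
      show "\<Union> (\<pi> - {{0}}) \<subseteq> {1..d}"
      proof
        fix j assume "j \<in> \<Union> (\<pi> - {{0}})"
        then obtain B where B: "B \<in> \<pi> - {{0}}" "j \<in> B" by blast
        then have "j \<in> {0..d}" "j \<noteq> 0" using disj[OF B(1)] by (auto simp flip: U)
        then show "j \<in> {1..d}" by simp
      qed
      show "{1..d} \<subseteq> \<Union> (\<pi> - {{0}})"
      proof
        fix j assume j: "j \<in> {1..d}"
        then have "j \<in> \<Union>\<pi>" using U by simp
        then show "j \<in> \<Union> (\<pi> - {{0}})" using j by force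
      qed
    qed
  qed (use part in \<open>auto simp: partition_on_def disjoint_def disjnt_def\<close>)
  moreover have "card (\<pi> - {{0}}) + 2 = card {1..d}"
    using card_\<pi> \<pi>0 \<open>3 \<le> d\<close> scheme_finite[OF fusion] by simp
  moreover have "(\<Sum>i\<in>B. eigenvalue (A i) r) = (\<Sum>i\<in>B. eigenvalue (A i) s)"
    if "B \<in> \<pi> - {{0}}" "r \<in> R" "s \<in> R" for B r s
  proof -
    have "block_sum A B \<in> ?B" using that by (auto simp: bose_mesner_def intro: span_base)
    then have "eigenvalue (block_sum A B) r = eigenvalue (block_sum A B) s"
      using that by (intro const[of _ R]) (simp_all add: \<rho>_def)
    then show ?thesis by (simp add: block_sum_def eigenvalue_linear)
  qed
  ultimately show ?thesis unfolding collapses_def by blast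
qed

section \<open>Schemes with one shifted eigenvalue per row are amorphic\<close>

lemma block_sum_E_mult:
  assumes "U \<subseteq> {0..d}" "V \<subseteq> {0..d}"
  shows "block_sum E U ** block_sum E V = block_sum E (U \<inter> V)"
proof -
  have "U \<inter> V \<subseteq> {0..d}" using assms by auto
  then show ?thesis using assms
    by (simp add: block_sum_spectral spectral_mult flip: of_bool_conj)
qed

text \<open>
  Every merging of relations inherits all conditions of a scheme except the closure under products.
\<close>

lemma pointed_partition_fuses_if_closed:
  assumes \<pi>: "pointed_partition d \<pi>"
    and closed: "\<And>B C. B \<in> \<pi> \<Longrightarrow> C \<in> \<pi> \<Longrightarrow>
      block_sum A B ** block_sum A C \<in> span (block_sum A ` \<pi>)"
  shows "is_fusion_scheme d A \<pi>"
proof -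
  have part: "partition_on {0..d} \<pi>" and \<pi>0: "{0} \<in> \<pi>"
    using \<pi> by (auto simp: pointed_partition_def)
  have fin: "finite \<pi>" using part by (rule finite_elements[rotated]) simp
  have sub: "C \<subseteq> {0..d}" if "C \<in> \<pi>" for C using part that by (auto simp: partition_on_def)
  have fC: "finite C" if "C \<in> \<pi>" for C using sub[OF that] by (rule finite_subset) simp
  have orth: "A h \<bullet> A h' = 0" if "h \<le> d" "h' \<le> d" "h \<noteq> h'" for h h'
    using scheme_orthogonal_family[OF scheme] that by (auto simp: orthogonal_family_def)
  have nonzero: "block_sum A C \<noteq> 0" if C: "C \<in> \<pi>" for C
  proof
    assume 0: "block_sum A C = 0"
    obtain i where i: "i \<in> C" using part C by (metis partition_onD3 all_not_in_conv)
    have "block_sum A C \<bullet> A i = A i \<bullet> A i + (\<Sum>j\<in>C - {i}. A j \<bullet> A i)"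
      unfolding block_sum_def inner_sum_left using fC[OF C] i by (simp add: sum.remove)
    also have "(\<Sum>j\<in>C - {i}. A j \<bullet> A i) = 0"
    proof (intro sum.neutral ballI)
      fix j assume "j \<in> C - {i}"
      then have "j \<in> {0..d}" "i \<in> {0..d}" "j \<noteq> i" using sub[OF C] i by blast+
      then show "A j \<bullet> A i = 0" by (simp add: orth)
    qed
    finally show False
      using 0 scheme_orthogonal_family[OF scheme] sub[OF C] i by (auto simp: orthogonal_family_def)
  qed
  have zero_one: "block_sum A C $ x $ y \<in> {0, 1}" if C: "C \<in> \<pi>" for C x y
  proof (cases "\<exists>i\<in>C. A i $ x $ y \<noteq> 0")
    case False
    then show ?thesis by (simp add: block_sum_def)
  next
    case True
    then obtain i where i: "i \<in> C" "A i $ x $ y \<noteq> 0" by blast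
    have "block_sum A C $ x $ y = A i $ x $ y + (\<Sum>j\<in>C - {i}. A j $ x $ y)"
      using fC[OF C] i by (simp add: block_sum_def sum.remove)
    also have "(\<Sum>j\<in>C - {i}. A j $ x $ y) = 0"
      using scheme_disjoint[OF scheme, of i _ x y] sub[OF C] i by (intro sum.neutral) fastforce
    finally show ?thesis
      using scheme sub[OF C] i by (auto simp: symmetric_association_scheme_def)
  qed
  have total: "(\<Sum>C\<in>\<pi>. block_sum A C) = all_ones"
  proof -
    have "(\<Sum>C\<in>\<pi>. block_sum A C) = sum A (\<Union>\<pi>)"
      unfolding block_sum_def using part fC
      by (subst sum.Union_disjoint) (auto simp: partition_on_def disjoint_def)
    also have "\<Union>\<pi> = {0..d}" using part by (simp add: partition_on_def)
    finally show ?thesis using scheme_sum[OF scheme] by simp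
  qed
  have sym: "transpose (block_sum A C) = block_sum A C" if C: "C \<in> \<pi>" for C
    unfolding block_sum_def linear_sum[OF linear_transpose]
    using sub[OF C] scheme by (intro sum.cong) (auto simp: symmetric_association_scheme_def)
  have "\<exists>q. block_sum A B ** block_sum A C = (\<Sum>D\<in>\<pi>. q D *\<^sub>R block_sum A D)"
    if "B \<in> \<pi>" "C \<in> \<pi>" for B C
    using in_span_image_sum[OF fin closed[OF that]] .
  then obtain p where "\<And>B C. B \<in> \<pi> \<Longrightarrow> C \<in> \<pi> \<Longrightarrow>
      block_sum A B ** block_sum A C = (\<Sum>D\<in>\<pi>. p B C D *\<^sub>R block_sum A D)"
    by metis
  then have "\<exists>p. \<forall>B\<in>\<pi>. \<forall>C\<in>\<pi>.
      block_sum A B ** block_sum A C = (\<Sum>D\<in>\<pi>. p B C D *\<^sub>R block_sum A D)"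
    by blast
  moreover have "block_sum A {0} = mat 1" by (simp add: block_sum_def scheme_unit[OF scheme])
  ultimately show ?thesis
    unfolding is_fusion_scheme_def symmetric_association_scheme_def
    using \<pi> fin \<pi>0 nonzero zero_one total sym by blast
qed

text \<open>
  The merged relation of a block \<open>C\<close> is a combination of \<open>I\<close>, \<open>J\<close> and the idempotent that collects the \<open>E r\<close>
  with \<open>\<sigma> r\<close> in \<open>C\<close>. As \<open>x \<noteq> 0\<close>, this idempotent is conversely a combination of \<open>I\<close>, \<open>J\<close> and the
  merged relation. So the merged relations span the same space as a family of sums of the \<open>E r\<close> whose
  index sets are closed under intersection up to the empty set, and such a space is closed under
  multiplication.
\<close>

lemma amorphic_if_single_shift:
  assumes x: "x \<noteq> 0" and \<sigma>: "bij_betw \<sigma> {1..d} {1..d}"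
    and p: "\<And>r i. r \<in> {1..d} \<Longrightarrow> i \<in> {1..d} \<Longrightarrow>
      eigenvalue (A i) r = \<alpha> i + (if i = \<sigma> r then x else 0)"
  shows "amorphic d A"
  unfolding amorphic_def
proof (intro allI impI)
  fix \<pi> assume \<pi>: "pointed_partition d \<pi>"
  then have part: "partition_on {0..d} \<pi>" and \<pi>0: "{0} \<in> \<pi>"
    by (auto simp: pointed_partition_def)
  define S where "S C = {r\<in>{1..d}. \<sigma> r \<in> C}" for C
  define \<S> where "\<S> = {{0}, {0..d}} \<union> S ` \<pi>"
  define a where "a C = (\<Sum>i\<in>C. \<alpha> i)" for C
  define b where "b C = eigenvalue (block_sum A C) 0 - a C" for C
  let ?W = "span (block_sum A ` \<pi>)" and ?G = "span (block_sum E ` \<S>)"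
  have \<S>_sub: "U \<subseteq> {0..d}" if "U \<in> \<S>" for U using that by (auto simp: \<S>_def S_def)
  have E0: "block_sum E {0} = E 0" by (simp add: block_sum_def)
  have one: "block_sum E {0..d} = mat 1" by (simp add: block_sum_def mat_1_eq spectral_def)
  have A0: "block_sum A {0} = mat 1" by (simp add: block_sum_def scheme_unit[OF scheme])
  have blocks: "C \<subseteq> {1..d}" if "C \<in> \<pi>" "C \<noteq> {0}" for C
  proof -
    have "C \<subseteq> {0..d}" using part that(1) by (auto simp: partition_on_def)
    moreover have "0 \<notin> C"
      using disjointD[OF partition_onD2[OF part] that(1) \<pi>0] that(2) by auto
    ultimately have "C \<subseteq> {0..d} - {0}" by blast
    also have "{0..d} - {0} = {1..d}" by auto
    finally show ?thesis .
  qed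
  have block_A: "block_sum A C = b C *\<^sub>R E 0 + a C *\<^sub>R mat 1 + x *\<^sub>R block_sum E (S C)"
    if C: "C \<in> \<pi>" "C \<noteq> {0}" for C
  proof -
    have fC: "finite C" using blocks[OF C] by (rule finite_subset) simp
    have S: "S C \<subseteq> {0..d}" by (auto simp: S_def)
    have "block_sum A C \<in> bose_mesner {0..d} A"
      using blocks[OF C] unfolding block_sum_def bose_mesner_def by (intro span_sum span_base) auto
    then have "block_sum A C = spectral (eigenvalue (block_sum A C))" by (simp add: spectral_eigenvalue)
    also have "\<dots> = spectral (\<lambda>j. b C * of_bool (j \<in> {0}) + a C * 1 + x * of_bool (j \<in> S C))"
      unfolding spectral_def
    proof (intro sum.cong refl)
      fix j assume j: "j \<in> {0..d}"
      have "eigenvalue (block_sum A C) j = b C * of_bool (j \<in> {0}) + a C * 1 + x * of_bool (j \<in> S C)"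
      proof (cases "j = 0")
        case True then show ?thesis by (simp add: b_def S_def)
      next
        case False
        then have j1: "j \<in> {1..d}" using j by simp
        have "eigenvalue (block_sum A C) j = (\<Sum>i\<in>C. \<alpha> i + (if i = \<sigma> j then x else 0))"
          unfolding block_sum_def eigenvalue_linear using p[OF j1] blocks[OF C] by (intro sum.cong) auto
        then show ?thesis using fC j1 False by (simp add: sum.distrib a_def S_def)
      qed
      then show "eigenvalue (block_sum A C) j *\<^sub>R E j =
          (b C * of_bool (j \<in> {0}) + a C * 1 + x * of_bool (j \<in> S C)) *\<^sub>R E j" by simp
    qed
    also have "\<dots> = b C *\<^sub>R E 0 + a C *\<^sub>R mat 1 + x *\<^sub>R block_sum E (S C)"
      unfolding spectral_linear mat_1_eq[symmetric] block_sum_spectral[OF S]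
        E0[symmetric] using block_sum_spectral[of "{0}"] by simp
    finally show ?thesis .
  qed
  have in_G: "block_sum E U \<in> ?G" if "U \<in> \<S>" for U using that by (intro span_base) auto
  have E0_G: "E 0 \<in> ?G" and one_G: "mat 1 \<in> ?G"
    using in_G[of "{0}"] in_G[of "{0..d}"] E0 one by (auto simp: \<S>_def)
  have A_G: "block_sum A C \<in> ?G" if C: "C \<in> \<pi>" for C
  proof (cases "C = {0}")
    case True then show ?thesis using A0 one_G by simp
  next
    case False
    have "S C \<in> \<S>" using C by (auto simp: \<S>_def)
    then show ?thesis unfolding block_A[OF C False]
      using E0_G one_G in_G by (intro span_add span_scale) auto
  qed
  have A_W: "block_sum A C \<in> ?W" if "C \<in> \<pi>" for C using that by (intro span_base) auto
  have one_W: "mat 1 \<in> ?W" using A_W[OF \<pi>0] A0 by simp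
  have E0_W: "E 0 \<in> ?W"
  proof -
    have "finite C" if "C \<in> \<pi>" for C
      using part that by (auto simp: partition_on_def intro: finite_subset)
    then have "(\<Sum>C\<in>\<pi>. block_sum A C) = sum A (\<Union>\<pi>)"
      unfolding block_sum_def using part
      by (subst sum.Union_disjoint) (auto simp: partition_on_def disjoint_def)
    also have "\<Union>\<pi> = {0..d}" using part by (simp add: partition_on_def)
    finally have "real CARD('x) *\<^sub>R E 0 = (\<Sum>C\<in>\<pi>. block_sum A C)"
      using scheme_sum[OF scheme] all_ones_eq by simp
    also have "\<dots> \<in> ?W" using A_W by (intro span_sum)
    finally have "(1 / real CARD('x)) *\<^sub>R real CARD('x) *\<^sub>R E 0 \<in> ?W" by (rule span_scale)
    then show ?thesis by simp
  qed
  have G_W: "block_sum E U \<in> ?W" if U: "U \<in> \<S>" for U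
  proof -
    consider "U = {0}" | "U = {0..d}" | C where "C \<in> \<pi>" "U = S C" using U by (auto simp: \<S>_def)
    then show ?thesis
    proof cases
      case 3
      show ?thesis
      proof (cases "C = {0}")
        case True
        then have "U = {}" using 3 \<sigma> by (force simp: S_def bij_betw_def)
        then show ?thesis by (simp add: block_sum_def span_zero)
      next
        case False
        have "block_sum E U = (1 / x) *\<^sub>R (block_sum A C - b C *\<^sub>R E 0 - a C *\<^sub>R mat 1)"
          using x by (simp add: block_A[OF 3(1) False] 3(2))
        also have "\<dots> \<in> ?W" using A_W[OF 3(1)] E0_W one_W by (intro span_scale span_diff)
        finally show ?thesis .
      qed
    qed (use E0_W one_W E0 one in auto)
  qed
  have inter: "U \<inter> V = {} \<or> U \<inter> V \<in> \<S>" if "U \<in> \<S>" "V \<in> \<S>" for U V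
  proof -
    have "S B \<inter> S C = {} \<or> S B = S C" if "B \<in> \<pi>" "C \<in> \<pi>" for B C
      using part that by (auto simp: partition_on_def disjoint_def S_def)
    then have SS: "S B \<inter> S C = {} \<or> S B \<inter> S C \<in> \<S>" if "B \<in> \<pi>" "C \<in> \<pi>" for B C
      using that unfolding \<S>_def by (metis Int_absorb UnI2 imageI)
    have whole: "U \<inter> {0..d} = U" "{0..d} \<inter> V = V" using \<S>_sub that by auto
    consider "U = {0..d} \<or> V = {0..d}" | "U = {0} \<or> V = {0}" | B C where "B \<in> \<pi>" "C \<in> \<pi>" "U = S B" "V = S C"
      using \<open>U \<in> \<S>\<close> \<open>V \<in> \<S>\<close> unfolding \<S>_def by blast
    then show ?thesis
    proof cases
      case 1 then show ?thesis using whole that by auto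
    next
      case 2
      then have "U \<inter> V = {} \<or> U \<inter> V = {0}" by auto
      moreover have "{0} \<in> \<S>" by (simp add: \<S>_def)
      ultimately show ?thesis by metis
    next
      case 3 then show ?thesis using SS by simp
    qed
  qed
  have G_mult: "X ** Y \<in> ?G" if "X \<in> ?G" "Y \<in> ?G" for X Y
  proof (rule span_closed_under_matrix_mult[OF _ that])
    fix X Y assume "X \<in> block_sum E ` \<S>" "Y \<in> block_sum E ` \<S>"
    then obtain U V where UV: "U \<in> \<S>" "V \<in> \<S>" "X = block_sum E U" "Y = block_sum E V" by auto
    then have "X ** Y = block_sum E (U \<inter> V)" using \<S>_sub by (simp add: block_sum_E_mult)
    then show "X ** Y \<in> ?G"
      using inter[OF UV(1,2)] in_G by (auto simp: block_sum_def span_zero)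
  qed
  have "?G \<subseteq> ?W" using G_W by (intro span_minimal) auto
  then show "is_fusion_scheme d A \<pi>"
    using A_G G_mult by (intro pointed_partition_fuses_if_closed[OF \<pi>]) blast
qed

section \<open>Sunflowers of fusing triples\<close>

text \<open>
  The edges cover the vertex set and contain the core, which has one element less than an edge. Hence
  every vertex outside the core forms an edge with it.
\<close>

lemma sunflower_core_triples_fuse:
  assumes S: "sunflower3 S" "fst S = E ` {1..d}"
    and sub: "subhypergraph S (fusing_idempotents_3_hypergraph d A E)"
  obtains a b where "a \<in> {1..d}" "b \<in> {1..d}" "a \<noteq> b" "core S = E ` {a, b}"
    "\<And>c. c \<in> {1..d} - {a, b} \<Longrightarrow> idempotents_fuse d A E {a, b, c}"
proof -
  have inj: "inj_on E {1..d}" using E_inj by (rule inj_on_subset) auto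
  have edges: "\<exists>J\<subseteq>{1..d}. f = E ` J \<and> card J = 3 \<and> idempotents_fuse d A E J" if "f \<in> snd S" for f
  proof -
    have "f \<in> {E ` J |J. J \<subseteq> {1..d} \<and> card J = 3 \<and> idempotents_fuse d A E J}"
      using sub that by (auto simp: subhypergraph_def fusing_idempotents_3_hypergraph_def)
    then show ?thesis by blast
  qed
  obtain f where "f \<in> snd S" using S by (auto simp: sunflower3_def)
  then have "core S \<subseteq> f" "f \<subseteq> E ` {1..d}" using edges[of f] by (auto simp: core_def)
  then have "core S \<subseteq> E ` {1..d}" by blast
  moreover obtain X Y where XY: "core S = {X, Y}" "X \<noteq> Y"
    using S by (auto simp: sunflower3_def card_2_iff)
  ultimately obtain a b where ab: "a \<in> {1..d}" "b \<in> {1..d}" "X = E a" "Y = E b" by auto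
  show ?thesis
  proof (rule that[OF ab(1,2)])
    show "a \<noteq> b" using XY ab by auto
    show "core S = E ` {a, b}" using XY ab by simp
    fix c assume c: "c \<in> {1..d} - {a, b}"
    then have "E c \<in> \<Union> (snd S)" using S by (auto simp: sunflower3_def)
    then obtain f where f: "f \<in> snd S" "E c \<in> f" by auto
    then obtain J where J: "J \<subseteq> {1..d}" "f = E ` J" "card J = 3" "idempotents_fuse d A E J"
      using edges by blast
    have "E a \<in> f" "E b \<in> f" using f(1) XY ab by (auto simp: core_def)
    then have "{a, b, c} \<subseteq> J" using f(2) J(1,2) inj ab c by (auto simp: inj_on_image_mem_iff)
    moreover have "card {a, b, c} = 3" using c \<open>a \<noteq> b\<close> by auto
    moreover have "finite J" using J(1) by (rule finite_subset) simp
    ultimately have "{a, b, c} = J" using J(3) by (intro card_subset_eq) auto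
    then show "idempotents_fuse d A E {a, b, c}" using J(4) by simp
  qed
qed

end

theorem theorem4p1:
  fixes d :: nat
    and A E :: "nat \<Rightarrow> real ^ 'x ^ 'x"
  assumes "d \<ge> 5"
    and "symmetric_association_scheme {0..d} 0 A"
    and "idempotent_labelling d A E"
    and "\<exists>S1 S2. sunflower3 S1 \<and> sunflower3 S2 \<and>
           fst S1 = E ` {1..d} \<and> fst S2 = E ` {1..d} \<and>
           core S1 \<noteq> core S2 \<and>
           subhypergraph S1 (fusing_idempotents_3_hypergraph d A E) \<and>
           subhypergraph S2 (fusing_idempotents_3_hypergraph d A E)"
  shows "amorphic d A"
proof -
  interpret labelled_scheme d A E using assms(1-3) by unfold_locales auto
  let ?p = "\<lambda>j i. eigenvalue (A i) j"
  interpret rows: eigenvalue_rows "{1..d}" "{1..d}" ?p valency size_over_multiplicity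
    using assms(1) by (rule eigenvalue_rows_axioms)
  obtain S1 S2 where S: "sunflower3 S1" "sunflower3 S2" "fst S1 = E ` {1..d}" "fst S2 = E ` {1..d}"
    "core S1 \<noteq> core S2" "subhypergraph S1 (fusing_idempotents_3_hypergraph d A E)"
    "subhypergraph S2 (fusing_idempotents_3_hypergraph d A E)"
    using assms(4) by blast
  obtain a b where ab: "a \<in> {1..d}" "b \<in> {1..d}" "a \<noteq> b" "core S1 = E ` {a, b}"
    and fuse1: "\<And>c. c \<in> {1..d} - {a, b} \<Longrightarrow> idempotents_fuse d A E {a, b, c}"
    using sunflower_core_triples_fuse[OF S(1,3,6)] by metis
  obtain a' b' where ab': "a' \<in> {1..d}" "b' \<in> {1..d}" "a' \<noteq> b'" "core S2 = E ` {a', b'}"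
    and fuse2: "\<And>c. c \<in> {1..d} - {a', b'} \<Longrightarrow> idempotents_fuse d A E {a', b', c}"
    using sunflower_core_triples_fuse[OF S(2,4,7)] by metis
  have collapse: "collapses {1..d} ?p {r, s, t}"
    if "idempotents_fuse d A E {r, s, t}" "r \<noteq> s" "t \<notin> {r, s}" for r s t
    using that by (intro fusing_idempotents_collapse) auto
  \<comment> \<open>Some vertex \<open>u\<close> of the second core lies outside the first one. If the other vertex \<open>v\<close> is in the
    first core, any triple on \<open>{u, v}\<close> with a third vertex outside meets the first core in one vertex;
    otherwise, \<open>{u, v, a}\<close> does.\<close>
  have "{a', b'} \<noteq> {a, b}" using S(5) ab(4) ab'(4) by auto
  then have "\<exists>u v. {u, v} = {a', b'} \<and> u \<noteq> v \<and> u \<notin> {a, b}"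
    using ab(3) ab'(3) by (metis doubleton_eq_iff insertE singletonD insert_commute)
  then obtain u v where uv: "{u, v} = {a', b'}" "u \<noteq> v" "u \<notin> {a, b}" by blast
  have uvd: "u \<in> {1..d}" "v \<in> {1..d}" using uv(1) ab' by (auto simp: doubleton_eq_iff)
  have fuse2': "idempotents_fuse d A E {u, v, c}" if "c \<in> {1..d} - {u, v}" for c
    using fuse2[of c] that uv(1) by (auto simp: doubleton_eq_iff insert_commute)
  have "\<exists>s c c'. s \<in> {a, b} \<and> c \<in> {1..d} - {a, b} \<and> c' \<in> {1..d} - {a, b} \<and> c \<noteq> c' \<and>
      collapses {1..d} ?p {s, c, c'}"
  proof (cases "v \<in> {a, b}")
    case True
    obtain c where c: "c \<in> {1..d} - {a, b}" "c \<noteq> u"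
    proof -
      have "card ({1..d} - {a, b}) = d - 2" using ab by (simp add: card_Diff_subset)
      then have "3 \<le> card ({1..d} - {a, b})" using assms(1) by simp
      then show ?thesis by (rule third_element[of _ u u]) (rule that)
    qed
    have "collapses {1..d} ?p {u, v, c}"
      using c True uv(2,3) by (intro collapse fuse2') auto
    then have "collapses {1..d} ?p {v, u, c}" by (simp add: insert_commute)
    then show ?thesis using True c uvd uv(3) by blast
  next
    case False
    have "collapses {1..d} ?p {u, v, a}"
      using False uv ab by (intro collapse fuse2') auto
    then have "collapses {1..d} ?p {a, u, v}" by (simp add: insert_commute)
    then show ?thesis using False uvd uv(2,3) by blast
  qed
  then obtain s c c' where sc: "s \<in> {a, b}" "c \<in> {1..d} - {a, b}" "c' \<in> {1..d} - {a, b}" "c \<noteq> c'"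
    "collapses {1..d} ?p {s, c, c'}" by blast
  have core: "collapses {1..d} ?p {a, b, c}" if "c \<in> {1..d} - {a, b}" for c
    using that ab by (intro collapse fuse1) auto
  obtain \<alpha> x \<sigma> where "x \<noteq> 0" "bij_betw \<sigma> {1..d} {1..d}"
    "\<And>r l. r \<in> {1..d} \<Longrightarrow> l \<in> {1..d} \<Longrightarrow> ?p r l = \<alpha> l + (if l = \<sigma> r then x else 0)"
    using rows.rows_of_two_sunflowers[OF ab(1-3) core sc] by metis
  then show ?thesis by (rule amorphic_if_single_shift)
qed

end
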